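(* Let $K$ be a field of arbitrary characteristic. Let $f(X)=X^r+a_{r-1}X^{r-1}+\dots+a_1X+a_0\in K[X]$ be a monic polynomial of degree $r\ge 2$, let $\varphi(X,Z)=Z^d+c_{d-1}(X)Z^{d-1}+\dots+c_1(X)Z+c_0(X)\in K[X,Z]$ (with $c_i\in K[X]$) where $d\ge 2$, and let $$A=\frac{K[X,Y,Z]}{(f(X)Y-\varphi(X,Z))}.$$ Let $x$ denote the image of $X$ in $A$. Then for every nontrivial exponential map $\phi$ on $A$, the ring of invariants is $A^{\phi}=K[x]$.
   Context: Exponential map: for a $K$-algebra $A$ and an indeterminate $U$, a $K$-algebra homomorphism $\phi=\phi_U:A\to A[U]$ is an exponential map on $A$ if (i) $\epsilon_0\circ\phi_U$ is the identity on $A$, where $\epsilon_0:A[U]\to A$ is evaluation at $U=0$; and (ii) $\phi_V\circ\phi_U=\phi_{V+U}$, where $V$ is another indeterminate and $\phi_V:A\to A[V]$ is extended to $\phi_V:A[U]\to A[U,V]$ by $\phi_V(U)=U$. The ring of invariants of $\phi$ is $A^{\phi}=\{a\in A:\phi(a)=a\}$. The map $\phi$ is trivial if $A^{\phi}=A$, and nontrivial otherwise. *)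

theory Defs
  imports
    "HOL-Algebra.Algebra"
    "HOL-Algebra.Algebraic_Closure_Type"
    "HOL-Computational_Algebra.Polynomial"
begin

text \<open>
  An algebra over a field \<open>K\<close> (the type \<open>'k\<close>) is a commutative ring \<open>A\<close> together with its
  structure map \<open>\<iota> : K \<rightarrow> A\<close>. The ring \<open>A[U]\<close> is \<^term>\<open>UP A\<close>.
\<close>

definition const_poly :: "('a, 'm) ring_scheme \<Rightarrow> 'a \<Rightarrow> nat \<Rightarrow> 'a" where
  "const_poly R a = up_ring.monom (UP R) a 0"

definition indet :: "('a, 'm) ring_scheme \<Rightarrow> nat \<Rightarrow> 'a" where
  "indet R = up_ring.monom (UP R) \<one>\<^bsub>R\<^esub> 1"

text \<open>
  The ring \<open>A[U,V]\<close> is rendered as \<open>A[U][V]\<close>, that is \<^term>\<open>UP (UP A)\<close>; thus \<open>U\<close> is a constant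
  polynomial there and \<open>V\<close> is the outer indeterminate.
\<close>

definition biconst :: "('a, 'm) ring_scheme \<Rightarrow> 'a \<Rightarrow> nat \<Rightarrow> nat \<Rightarrow> 'a" where
  "biconst A a = const_poly (UP A) (const_poly A a)"

definition indet_U :: "('a, 'm) ring_scheme \<Rightarrow> nat \<Rightarrow> nat \<Rightarrow> 'a" where
  "indet_U A = const_poly (UP A) (indet A)"

definition indet_V :: "('a, 'm) ring_scheme \<Rightarrow> nat \<Rightarrow> nat \<Rightarrow> 'a" where
  "indet_V A = indet (UP A)"

text \<open>
  For \<open>\<phi> : A \<rightarrow> A[U]\<close> and \<open>t \<in> A[U,V]\<close>, \<open>exp_at A \<phi> t\<close> is the map \<open>\<phi>\<^sub>t : A \<rightarrow> A[U,V]\<close> obtained from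
  \<open>\<phi>\<close> by substituting \<open>t\<close> for the indeterminate. The extension of \<open>\<phi>\<^sub>V\<close> to \<open>A[U] \<rightarrow> A[U,V]\<close> with
  \<open>U \<mapsto> U\<close> is evaluation at \<open>U\<close> with coefficients mapped by \<open>\<phi>\<^sub>V\<close>.
\<close>

definition exp_at ::
  "('a, 'm) ring_scheme \<Rightarrow> ('a \<Rightarrow> nat \<Rightarrow> 'a) \<Rightarrow> (nat \<Rightarrow> nat \<Rightarrow> 'a) \<Rightarrow> 'a \<Rightarrow> nat \<Rightarrow> nat \<Rightarrow> 'a" where
  "exp_at A \<phi> t a = eval A (UP (UP A)) (biconst A) t (\<phi> a)"

definition exp_V_ext ::
  "('a, 'm) ring_scheme \<Rightarrow> ('a \<Rightarrow> nat \<Rightarrow> 'a) \<Rightarrow> (nat \<Rightarrow> 'a) \<Rightarrow> nat \<Rightarrow> nat \<Rightarrow> 'a" where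
  "exp_V_ext A \<phi> = eval A (UP (UP A)) (exp_at A \<phi> (indet_V A)) (indet_U A)"

definition exponential_map ::
  "('a, 'm) ring_scheme \<Rightarrow> ('k \<Rightarrow> 'a) \<Rightarrow> ('a \<Rightarrow> nat \<Rightarrow> 'a) \<Rightarrow> bool" where
  "exponential_map A \<iota> \<phi> \<longleftrightarrow>
     \<phi> \<in> ring_hom A (UP A) \<and>
     (\<forall>c. \<phi> (\<iota> c) = const_poly A (\<iota> c)) \<and>
     (\<forall>a \<in> carrier A. eval A A (\<lambda>b. b) \<zero>\<^bsub>A\<^esub> (\<phi> a) = a) \<and>
     (\<forall>a \<in> carrier A. exp_V_ext A \<phi> (\<phi> a) =
        exp_at A \<phi> (indet_V A \<oplus>\<^bsub>UP (UP A)\<^esub> indet_U A) a)"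

definition ring_of_invariants :: "('a, 'm) ring_scheme \<Rightarrow> ('a \<Rightarrow> nat \<Rightarrow> 'a) \<Rightarrow> 'a set" where
  "ring_of_invariants A \<phi> = {a \<in> carrier A. \<phi> a = const_poly A a}"

definition trivial_exp :: "('a, 'm) ring_scheme \<Rightarrow> ('a \<Rightarrow> nat \<Rightarrow> 'a) \<Rightarrow> bool" where
  "trivial_exp A \<phi> \<longleftrightarrow> ring_of_invariants A \<phi> = carrier A"

definition subalgebra_gen ::
  "('a, 'm) ring_scheme \<Rightarrow> ('k \<Rightarrow> 'a) \<Rightarrow> 'a set \<Rightarrow> 'a set" where
  "subalgebra_gen A \<iota> S = generate_ring A (range \<iota> \<union> S)"

text \<open>
  \<open>K[X,Y,Z]\<close> is rendered as \<open>K[X][Z][Y]\<close>: the innermost variable of \<^typ>\<open>'k poly poly poly\<close> is \<open>X\<close>,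
  the middle one \<open>Z\<close> and the outermost one \<open>Y\<close>. Accordingly \<open>g(X,Z) \<in> K[X][Z]\<close> has type
  \<^typ>\<open>'k poly poly\<close>, and its degree and leading coefficient are those with respect to \<open>Z\<close>.
\<close>

definition polyXYZ :: "'k::field poly poly poly ring" where
  "polyXYZ = ring_of_type_algebra"

definition varX :: "'k::field poly poly poly" where
  "varX = [:[:[:0, 1:]:]:]"

definition varY :: "'k::field poly poly poly" where
  "varY = [:0, 1:]"

definition surface_rel :: "'k::field poly \<Rightarrow> 'k poly poly \<Rightarrow> 'k poly poly poly" where
  "surface_rel f g = [:[:f:]:] * varY - [:g:]"

definition surface_ideal :: "'k::field poly \<Rightarrow> 'k poly poly \<Rightarrow> 'k poly poly poly set" where
  "surface_ideal f g = PIdl\<^bsub>polyXYZ\<^esub> (surface_rel f g)"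

definition surface_ring :: "'k::field poly \<Rightarrow> 'k poly poly \<Rightarrow> 'k poly poly poly set ring" where
  "surface_ring f g = polyXYZ Quot surface_ideal f g"

definition surface_class ::
  "'k::field poly \<Rightarrow> 'k poly poly \<Rightarrow> 'k poly poly poly \<Rightarrow> 'k poly poly poly set" where
  "surface_class f g p = surface_ideal f g +>\<^bsub>polyXYZ\<^esub> p"

definition surface_const ::
  "'k::field poly \<Rightarrow> 'k poly poly \<Rightarrow> 'k \<Rightarrow> 'k poly poly poly set" where
  "surface_const f g c = surface_class f g [:[:[:c:]:]:]"

end

theory Submission
  imports Defs
begin

text \<open>
  Write \<open>r\<close> and \<open>d\<close> for the degrees of \<open>f\<close> and \<open>g\<close>. Sending \<open>y\<close> to \<open>g / f\<close> embeds the surface ring \<open>A\<close>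
  into \<open>K((1/x))[z]\<close>. There every nonzero element \<open>b\<close> has a value \<open>v(b)\<close>, the degree in \<open>z\<close> together
  with the degree in \<open>x\<close> of the leading coefficient, ordered with \<open>z\<close> dominating, and a leading scalar.
  This turns sums and products into leading-term arithmetic. Since \<open>f\<close> and \<open>g\<close> are monic,
  \<open>v(y) = d v(z) - r v(x)\<close>, and since classes have representatives of degree below \<open>d\<close> in \<open>Z\<close>
  (\<open>reduced_form\<close>), the values on \<open>A\<close> are just those of the monomials \<open>x^i y^k z^j\<close> (\<open>val_embed\<close>).
  In other words, \<open>A\<close> degenerates to the ring of \<open>X^r Y = Z^d\<close>, in which each value belongs to a
  line.

  Now let \<open>\<phi>(b) = \<Sum> D_i(b) U^i\<close> be a nontrivial exponential map. Give \<open>U\<close> a weight \<open>\<mu>\<close> such that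
  always \<open>v(D_i b) \<le> v(b) - i \<mu>\<close>, with equality for some generator and some \<open>i \<ge> 1\<close>. The leading
  scalars of those \<open>D_i(b)\<close> for which equality holds are the coefficients of a polynomial over \<open>K\<close>, the
  symbol of \<open>b\<close>. Symbols are multiplicative, and up to a scalar they depend only on \<open>v(b)\<close>. Let \<open>p\<close>,
  \<open>l\<close>, \<open>q\<close> be the degrees of the symbols of \<open>x\<close>, \<open>y\<close>, \<open>z\<close>, so that \<open>r p + l = d q\<close> and \<open>q > 0\<close>. By the
  composition law of \<open>\<phi>\<close>, an element \<open>D_n(b)\<close> that carries the top coefficient of the symbol of \<open>b\<close>
  has a constant symbol.

  The heart of the proof is that \<open>p = 0\<close> (\<open>p_eq_0\<close>). If \<open>p > 0\<close>, the elements carrying the top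
  coefficients for \<open>x\<close> and \<open>z\<close> can only have the values of powers \<open>y^k\<close> and \<open>y^k'\<close>. Comparing values
  gives \<open>l = 0\<close> and \<open>d k' = 1 + r k\<close>. So \<open>r\<close> and \<open>d\<close> are coprime, and the symbols of \<open>x\<close> and \<open>z\<close>, whose
  \<open>r\<close>-th and \<open>d\<close>-th powers agree, are \<open>H^d\<close> and \<open>H^r\<close> for a single polynomial \<open>H\<close>. One of \<open>d\<close> and \<open>r\<close>
  is nonzero in \<open>K\<close>, and for it the power of \<open>H\<close> has a nonzero coefficient at distance between 1 and
  \<open>deg H\<close> below the top. This coefficient comes from an element of \<open>A\<close> whose symbol has degree in that
  range. But \<open>r, d \<ge> 2\<close>, so all positive degrees of symbols are at least \<open>2 deg H\<close>.

  From \<open>p = 0\<close> it follows that \<open>\<mu>\<close> has positive degree in \<open>z\<close>. Then \<open>D_i(x)\<close> for \<open>i \<ge> 1\<close> would have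
  negative degree in \<open>z\<close>, so it vanishes and \<open>x\<close> is invariant. An invariant has a constant symbol,
  hence degree 0 in \<open>z\<close>, and so it is a polynomial in \<open>x\<close>.
\<close>

unbundle fps_syntax

section \<open>Evaluation homomorphisms on polynomials\<close>

definition unital_hom :: "('a::comm_ring_1 \<Rightarrow> 'b::comm_ring_1) \<Rightarrow> bool" where
  "unital_hom \<sigma> \<longleftrightarrow> \<sigma> 1 = 1 \<and> (\<forall>a b. \<sigma> (a + b) = \<sigma> a + \<sigma> b) \<and> (\<forall>a b. \<sigma> (a * b) = \<sigma> a * \<sigma> b)"

lemma unital_homD:
  assumes "unital_hom \<sigma>"
  shows "\<sigma> 1 = 1" "\<sigma> (a + b) = \<sigma> a + \<sigma> b" "\<sigma> (a * b) = \<sigma> a * \<sigma> b"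
    and "\<sigma> 0 = 0" "\<sigma> (- a) = - \<sigma> a" "\<sigma> (a - b) = \<sigma> a - \<sigma> b"
proof -
  have add: "\<sigma> (a + b) = \<sigma> a + \<sigma> b" for a b
    using assms by (simp add: unital_hom_def)
  show "\<sigma> 1 = 1" "\<sigma> (a + b) = \<sigma> a + \<sigma> b" "\<sigma> (a * b) = \<sigma> a * \<sigma> b"
    using assms by (simp_all add: unital_hom_def)
  show zero: "\<sigma> 0 = 0"
    using add[of 0 0] by simp
  have minus: "\<sigma> (- a) = - \<sigma> a" for a
    using add[of a "- a"] zero by (simp add: minus_unique)
  show "\<sigma> (- a) = - \<sigma> a" "\<sigma> (a - b) = \<sigma> a - \<sigma> b"
    using add[of a "- b"] minus by simp_all
qed

definition eval_hom :: "('a::comm_ring_1 \<Rightarrow> 'b::comm_ring_1) \<Rightarrow> 'b \<Rightarrow> 'a poly \<Rightarrow> 'b" where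
  "eval_hom \<sigma> t p = fold_coeffs (\<lambda>a s. \<sigma> a + t * s) p 0"

lemma eval_hom_0 [simp]: "eval_hom \<sigma> t 0 = 0"
  by (simp add: eval_hom_def)

lemma eval_hom_pCons:
  assumes "unital_hom \<sigma>"
  shows "eval_hom \<sigma> t (pCons a p) = \<sigma> a + t * eval_hom \<sigma> t p"
  by (cases "p = 0"; cases "a = 0") (auto simp: eval_hom_def unital_homD[OF assms])

lemma unital_hom_eval_hom:
  assumes \<sigma>: "unital_hom \<sigma>"
  shows "unital_hom (eval_hom \<sigma> t)"
proof -
  note [simp] = eval_hom_pCons[OF \<sigma>] unital_homD[OF \<sigma>]
  have add: "eval_hom \<sigma> t (p + q) = eval_hom \<sigma> t p + eval_hom \<sigma> t q" for p q
    by (induction p q rule: poly_induct2) (simp_all add: algebra_simps)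
  have smult: "eval_hom \<sigma> t (smult a p) = \<sigma> a * eval_hom \<sigma> t p" for a p
    by (induction p) (simp_all add: algebra_simps)
  have mult: "eval_hom \<sigma> t (p * q) = eval_hom \<sigma> t p * eval_hom \<sigma> t q" for p q
    by (induction p) (simp_all add: add smult algebra_simps)
  show ?thesis
    unfolding unital_hom_def using add mult by (simp add: one_pCons)
qed

section \<open>Leading terms in \<open>K((1/x))[z]\<close>\<close>

text \<open>
  A pair of degrees is encoded as a polynomial of degree at most 1 over the rationals: the order of
  \<open>rat poly\<close> compares leading coefficients first, so it is the lexicographic order with the degree in
  \<open>z\<close> dominating. Rational coefficients leave room for slopes, which need not be integral.
\<close>

definition weight :: "int \<Rightarrow> int \<Rightarrow> rat poly" where
  "weight m n = [:of_int m, of_int n:]"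

text \<open>
  The element \<open>x\<close> will be the inverse of the Laurent variable, so degrees in \<open>x\<close> are negated
  subdegrees. The value of 0 is the weight 0 by default, so bounds on values treat 0 separately
  (\<open>below\<close>).
\<close>

definition val :: "'k::field fls poly \<Rightarrow> rat poly" where
  "val b = weight (- fls_subdegree (lead_coeff b)) (int (degree b))"

definition lead_scalar :: "'k::field fls poly \<Rightarrow> 'k" where
  "lead_scalar b = lead_coeff b $$ fls_subdegree (lead_coeff b)"

definition scal :: "'k::field \<Rightarrow> 'k fls poly" where
  "scal c = [:fls_const c:]"

lemma weight_add: "weight m n + weight m' n' = weight (m + m') (n + n')"
  by (simp add: weight_def)

lemma weight_eq_iff: "weight m n = weight m' n' \<longleftrightarrow> m = m' \<and> n = n'"
  by (simp add: weight_def)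

lemma weight_less_iff: "weight m n < weight m' n' \<longleftrightarrow> n < n' \<or> (n = n' \<and> m < m')"
  by (auto simp: weight_def less_poly_def pos_poly_pCons)

lemma le_poly_imp_coeff_1_le:
  assumes "[:a, b:] \<le> [:a', b'::rat:]"
  shows "b \<le> b'"
  using assms by (auto simp: less_eq_poly_def pos_poly_pCons split: if_splits)

lemma lead_scalar_eq_0_iff [simp]: "lead_scalar b = 0 \<longleftrightarrow> b = 0"
  by (simp add: lead_scalar_def nth_fls_subdegree_zero_iff)

lemma val_mult:
  assumes "a \<noteq> 0" "b \<noteq> 0"
  shows "val (a * b) = val a + val b"
proof -
  have "lead_coeff (a * b) = lead_coeff a * lead_coeff b" "degree (a * b) = degree a + degree b"
    using assms by (rule_tac lead_coeff_mult, simp only: degree_mult_eq not_False_eq_True)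
  then show ?thesis using assms by (simp only: val_def weight_add) simp
qed

lemma lead_scalar_mult: "lead_scalar (a * b) = lead_scalar a * lead_scalar b"
  by (cases "a = 0 \<or> b = 0") (auto simp: lead_scalar_def lead_coeff_mult fls_times_base)

lemma val_lead_scalarI:
  assumes deg: "\<And>i. i > n \<Longrightarrow> poly.coeff b i = 0"
    and sub: "\<And>i. i < - m \<Longrightarrow> poly.coeff b n $$ i = 0"
    and nz: "poly.coeff b n $$ (- m) \<noteq> 0"
  shows "val b = weight m (int n)" "lead_scalar b = poly.coeff b n $$ (- m)"
proof -
  have "poly.coeff b n \<noteq> 0" using nz by auto
  then have "degree b = n" using deg
    by (meson le_antisym le_degree leading_coeff_0_iff not_le degree_le)
  moreover have "fls_subdegree (poly.coeff b n) = - m"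
    using nz sub by (rule fls_subdegree_eqI)
  ultimately show "val b = weight m (int n)" "lead_scalar b = poly.coeff b n $$ (- m)"
    by (simp_all add: val_def lead_scalar_def)
qed

lemma val_add_less:
  assumes "b \<noteq> 0" and "a = 0 \<or> val a < val b"
  shows "val (a + b) = val b" "lead_scalar (a + b) = lead_scalar b"
proof -
  let ?n = "degree b" and ?m = "- fls_subdegree (lead_coeff b)"
  have *: "poly.coeff a i = 0" if "i > ?n" for i
    using that assms by (auto simp: val_def weight_less_iff coeff_eq_0)
  have **: "poly.coeff a ?n $$ i = 0" if "i \<le> - ?m" for i
  proof (cases "a = 0 \<or> degree a < ?n")
    case False
    then have "degree a = ?n" "fls_subdegree (lead_coeff b) < fls_subdegree (lead_coeff a)"
      using assms by (auto simp: val_def weight_less_iff)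
    then show ?thesis using that by simp
  qed (auto simp: coeff_eq_0)
  have "poly.coeff (a + b) ?n $$ (- ?m) \<noteq> 0"
    using ** assms by simp
  from val_lead_scalarI[OF _ _ this]
  show "val (a + b) = val b" "lead_scalar (a + b) = lead_scalar b"
    using * ** by (auto simp: coeff_eq_0 val_def lead_scalar_def)
qed

text \<open>
  A leading term is a scalar multiple of a single power product, so elements of equal value and
  opposite leading scalars cancel to something of smaller value.
\<close>

lemma val_add_same:
  assumes "a \<noteq> 0" "b \<noteq> 0" "val a = val b"
  shows "lead_scalar a + lead_scalar b \<noteq> 0 \<Longrightarrow> val (a + b) = val b"
    and "lead_scalar a + lead_scalar b \<noteq> 0 \<Longrightarrow> lead_scalar (a + b) = lead_scalar a + lead_scalar b"
    and "lead_scalar a + lead_scalar b = 0 \<Longrightarrow> a + b = 0 \<or> val (a + b) < val b"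
proof -
  let ?n = "degree b" and ?m = "- fls_subdegree (lead_coeff b)"
  have n: "degree a = ?n" and m: "fls_subdegree (lead_coeff a) = fls_subdegree (lead_coeff b)"
    using assms by (auto simp: val_def weight_eq_iff)
  have top: "poly.coeff (a + b) i = 0" if "i > ?n" for i
    using that n by (simp add: coeff_eq_0)
  have low: "poly.coeff (a + b) ?n $$ i = 0" if "i < - ?m" for i
    using that n m by simp
  have ls: "poly.coeff (a + b) ?n $$ (- ?m) = lead_scalar a + lead_scalar b"
    using n m by (simp add: lead_scalar_def)
  {
    assume "lead_scalar a + lead_scalar b \<noteq> 0"
    with val_lead_scalarI[of ?n "a + b" ?m, OF top low] ls
    show "val (a + b) = val b" "lead_scalar (a + b) = lead_scalar a + lead_scalar b"
      by (simp_all only: val_def[of b] not_False_eq_True simp_thms)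
  }
  assume 0: "lead_scalar a + lead_scalar b = 0"
  show "a + b = 0 \<or> val (a + b) < val b"
  proof (rule disjCI)
    assume "\<not> val (a + b) < val b"
    moreover have "degree (a + b) \<le> ?n" using n by (simp add: degree_add_le)
    ultimately have d: "degree (a + b) = ?n"
      and s: "fls_subdegree (lead_coeff (a + b)) \<le> - ?m"
      by (auto simp: val_def weight_less_iff)
    have "lead_coeff (a + b) $$ fls_subdegree (lead_coeff (a + b)) = 0"
      using low 0 ls s d by (cases "fls_subdegree (lead_coeff (a + b)) = - ?m") (simp_all only: )
    then show "a + b = 0"
      unfolding nth_fls_subdegree_zero_iff leading_coeff_0_iff .
  qed
qed

text \<open>
  The leading form of \<open>b\<close> in weight \<open>\<gamma>\<close>. Restricted to the elements satisfying \<open>below \<gamma>\<close>, it is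
  additive, and it is multiplicative over sums of weights.
\<close>

definition lead_at :: "rat poly \<Rightarrow> 'k::field fls poly \<Rightarrow> 'k" where
  "lead_at \<gamma> b = (if val b = \<gamma> then lead_scalar b else 0)"

definition below :: "rat poly \<Rightarrow> 'k::field fls poly \<Rightarrow> bool" where
  "below \<gamma> b \<longleftrightarrow> b = 0 \<or> val b \<le> \<gamma>"

lemma below_0 [simp]: "below \<gamma> 0"
  by (simp add: below_def)

lemma lead_at_0 [simp]: "lead_at \<gamma> 0 = 0"
  by (simp add: lead_at_def)

lemma below_mono: "below \<gamma> b \<Longrightarrow> \<gamma> \<le> \<delta> \<Longrightarrow> below \<delta> b"
  by (auto simp: below_def)

lemma lead_at_eq_0_if_less: "below \<gamma> b \<Longrightarrow> \<gamma> < \<delta> \<Longrightarrow> lead_at \<delta> b = 0"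
  by (auto simp: below_def lead_at_def)

lemma below_add:
  assumes "below \<gamma> a" "below \<gamma> b"
  shows "below \<gamma> (a + b)"
proof -
  consider "a = 0" | "b = 0" | "a \<noteq> 0" "b \<noteq> 0" by blast
  then show ?thesis
  proof cases
    case 3
    then show ?thesis
      using assms val_add_less[of b a] val_add_less[of a b] val_add_same[of a b]
      by (cases "val a" "val b" rule: linorder_cases; cases "lead_scalar a + lead_scalar b = 0")
         (auto simp: below_def add.commute)
  qed (use assms in auto)
qed

lemma lead_at_add:
  assumes "below \<gamma> a" "below \<gamma> b"
  shows "lead_at \<gamma> (a + b) = lead_at \<gamma> a + lead_at \<gamma> b"
proof -
  consider "a = 0" | "b = 0" | "a \<noteq> 0" "b \<noteq> 0" by blast
  then show ?thesis
  proof cases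
    case 3
    then show ?thesis
      using assms val_add_less[of b a] val_add_less[of a b] val_add_same[of a b]
      by (cases "val a" "val b" rule: linorder_cases; cases "lead_scalar a + lead_scalar b = 0")
         (auto simp: below_def lead_at_def add.commute)
  qed auto
qed

lemma below_mult:
  assumes "below \<gamma> a" "below \<delta> b"
  shows "below (\<gamma> + \<delta>) (a * b)"
  using assms by (cases "a = 0"; cases "b = 0") (simp_all add: below_def val_mult add_mono)

lemma lead_at_mult:
  assumes "below \<gamma> a" "below \<delta> b"
  shows "lead_at (\<gamma> + \<delta>) (a * b) = lead_at \<gamma> a * lead_at \<delta> b"
proof (cases "a = 0 \<or> b = 0")
  case False
  then have le: "val a \<le> \<gamma>" "val b \<le> \<delta>"
    using assms by (auto simp: below_def)
  have "val a + val b = \<gamma> + \<delta> \<longleftrightarrow> val a = \<gamma> \<and> val b = \<delta>"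
    using le by (metis add_le_less_mono add_less_le_mono less_irrefl order_le_less)
  then show ?thesis
    using False by (auto simp: lead_at_def val_mult lead_scalar_mult)
qed auto

lemma below_sum: "(\<And>i. i \<in> I \<Longrightarrow> below \<gamma> (F i)) \<Longrightarrow> below \<gamma> (sum F I)"
  by (induction I rule: infinite_finite_induct) (simp_all add: below_add)

lemma lead_at_sum:
  "(\<And>i. i \<in> I \<Longrightarrow> below \<gamma> (F i)) \<Longrightarrow> lead_at \<gamma> (sum F I) = (\<Sum>i\<in>I. lead_at \<gamma> (F i))"
  by (induction I rule: infinite_finite_induct) (simp_all add: lead_at_add below_sum)

lemma unital_hom_scal: "unital_hom scal"
  by (simp add: unital_hom_def scal_def fls_plus_const one_pCons mult.commute)

lemma scal_eq_0_iff [simp]: "scal c = 0 \<longleftrightarrow> c = 0"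
  by (simp add: scal_def)

lemma val_scal: "val (scal c) = 0"
  by (simp add: val_def scal_def weight_def)

lemma lead_scalar_scal: "lead_scalar (scal c) = c"
  by (simp add: lead_scalar_def scal_def)

lemma lead_at_scal_mult: "lead_at \<gamma> (scal c * b) = c * lead_at \<gamma> b"
  by (cases "c = 0 \<or> b = 0")
     (auto simp: lead_at_def val_mult val_scal lead_scalar_mult lead_scalar_scal)

section \<open>Polynomials in one variable over a field\<close>

lemma field_poly_prime_factor:
  fixes a :: "'k::field poly"
  assumes "degree a > 0"
  obtains \<pi> where "prime_elem \<pi>" "\<pi> dvd a"
proof -
  define P where "P \<pi> \<longleftrightarrow> \<pi> dvd a \<and> degree \<pi> > 0" for \<pi>
  have "P a" using assms by (simp add: P_def)
  then obtain \<pi> where \<pi>: "P \<pi>" and min: "\<And>\<rho>. P \<rho> \<Longrightarrow> degree \<pi> \<le> degree \<rho>"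
    using arg_min_nat_lemma[of P a degree] by blast
  have "comm_semiring_1_class.irreducible \<pi>"
  proof (rule Factorial_Ring.irreducibleI)
    show "\<pi> \<noteq> 0" "\<not> is_unit \<pi>"
      using \<pi> is_unit_iff_degree[of \<pi>] by (force simp: P_def)+
    fix \<rho> \<sigma> assume eq: "\<pi> = \<rho> * \<sigma>"
    then have nz: "\<rho> \<noteq> 0" "\<sigma> \<noteq> 0"
      using \<pi> by (auto simp: P_def)
    then have "degree \<pi> = degree \<rho> + degree \<sigma>"
      by (simp add: eq degree_mult_eq)
    moreover have "\<rho> dvd a" "\<sigma> dvd a"
      using \<pi> eq by (auto simp: P_def intro: dvd_trans)
    ultimately have "degree \<rho> = 0 \<or> degree \<sigma> = 0"
      using min[of \<rho>] min[of \<sigma>] by (force simp: P_def)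
    then show "is_unit \<rho> \<or> is_unit \<sigma>"
      using nz by (simp add: is_unit_iff_degree)
  qed
  then show ?thesis
    using that field_poly_irreducible_imp_prime \<pi> by (auto simp: P_def)
qed

text \<open>
  A prime factor of \<open>a\<close> divides \<open>b^n\<close> and hence \<open>b\<close>, so it can be removed from both; what remains of
  \<open>a\<close> in the end is a unit.
\<close>

lemma field_poly_power_dvd_cancel:
  fixes a b :: "'k::field poly"
  assumes "a ^ n dvd b ^ n" "n > 0" "a \<noteq> 0"
  shows "a dvd b"
  using assms
proof (induction "degree a" arbitrary: a b rule: less_induct)
  case less
  show ?case
  proof (cases "degree a = 0")
    case True
    then have "is_unit a" using less.prems by (simp add: is_unit_iff_degree)
    then show ?thesis by (rule unit_imp_dvd)
  next
    case False
    then obtain \<pi> where \<pi>: "prime_elem \<pi>" "\<pi> dvd a"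
      using field_poly_prime_factor by blast
    have "\<pi> dvd a ^ n" using \<pi> less.prems(2) by (meson dvd_power dvd_trans)
    then have "\<pi> dvd b ^ n" using less.prems(1) by (rule dvd_trans)
    then have "\<pi> dvd b" using \<pi>(1) prime_elem_dvd_power by blast
    then obtain a' b' where ab: "a = \<pi> * a'" "b = \<pi> * b'"
      using \<pi>(2) by (auto elim!: dvdE)
    have [simp]: "\<pi> \<noteq> 0" and "degree \<pi> \<noteq> 0"
      using \<pi>(1) is_unit_iff_degree[of \<pi>] by (auto simp: prime_elem_def)
    moreover have "a' \<noteq> 0" using less.prems(3) ab by auto
    ultimately have "degree a' < degree a" by (simp add: ab degree_mult_eq)
    moreover have "a' ^ n dvd b' ^ n"
      using less.prems(1) by (simp add: ab power_mult_distrib)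
    ultimately have "a' dvd b'"
      using less.hyps less.prems(2) \<open>a' \<noteq> 0\<close> by blast
    then show ?thesis by (simp add: ab)
  qed
qed

text \<open>
  The root is \<open>P^k' / Q^k\<close>; it is a polynomial because the \<open>d\<close>-th power of this fraction is \<open>P\<close>.
\<close>

lemma common_root_of_equal_powers:
  fixes P Q :: "'k::field poly"
  assumes eq: "P ^ r = Q ^ d" and bezout: "d * k' = 1 + r * k" and "d > 0" and "Q \<noteq> 0"
  obtains H where "P = H ^ d" "Q = H ^ r"
proof -
  have "(P ^ k') ^ d = P ^ (1 + r * k)"
    unfolding bezout[symmetric] by (simp add: power_mult[symmetric] mult.commute)
  also have "\<dots> = P * (P ^ r) ^ k" by (simp add: power_mult)
  also have "\<dots> = P * (Q ^ k) ^ d" by (simp add: eq power_mult[symmetric] mult.commute)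
  finally have 1: "(P ^ k') ^ d = P * (Q ^ k) ^ d" .
  then have "(Q ^ k) ^ d dvd (P ^ k') ^ d" by simp
  then have "Q ^ k dvd P ^ k'"
    using field_poly_power_dvd_cancel assms by (metis power_not_zero)
  then obtain H where H: "P ^ k' = Q ^ k * H" by (rule dvdE)
  have "H ^ d * (Q ^ k) ^ d = P * (Q ^ k) ^ d"
    using 1 by (simp add: H power_mult_distrib mult.commute)
  then have "P = H ^ d" using \<open>Q \<noteq> 0\<close> by simp
  moreover have "H ^ r * (Q ^ k) ^ r = Q * (Q ^ k) ^ r"
  proof -
    have "H ^ r * (Q ^ k) ^ r = (P ^ k') ^ r" by (simp add: H power_mult_distrib mult.commute)
    also have "\<dots> = (P ^ r) ^ k'" by (simp add: power_mult[symmetric] mult.commute)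
    also have "\<dots> = Q ^ (1 + r * k)" by (simp add: eq power_mult[symmetric] bezout)
    also have "\<dots> = Q * (Q ^ k) ^ r" by (simp add: power_mult[symmetric] mult.commute)
    finally show ?thesis .
  qed
  then have "Q = H ^ r" using \<open>Q \<noteq> 0\<close> by simp
  ultimately show ?thesis using that by blast
qed

text \<open>
  If all these coefficients vanished, a power of the variable exceeding the degree of \<open>R\<close> would
  divide \<open>R^n - c^n\<close> with \<open>c\<close> the constant term of \<open>R\<close>. The cofactor of \<open>R - c\<close> in this difference has
  constant term \<open>n c^(n-1) \<noteq> 0\<close>, so that power would divide \<open>R - c\<close>.
\<close>

lemma power_coeff_near_bottom:
  fixes R :: "'k::field poly"
  assumes R0: "poly.coeff R 0 \<noteq> 0" and "degree R > 0" and n: "of_nat n \<noteq> (0::'k)"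
  obtains j where "0 < j" "j \<le> degree R" "poly.coeff (R ^ n) j \<noteq> 0"
proof -
  define c where "c = [:poly.coeff R 0:]"
  from n obtain m where m: "n = Suc m" by (cases n) auto
  define T where "T = (\<Sum>i<n. R ^ i * c ^ (m - i))"
  have fact: "R ^ n - c ^ n = (R - c) * T"
    unfolding T_def m by (rule diff_power_eq_sum)
  have "R \<noteq> c" using \<open>degree R > 0\<close> unfolding c_def by (metis degree_pCons_0 less_irrefl)
  have "poly T 0 = (\<Sum>i<n. poly.coeff R 0 ^ i * poly.coeff R 0 ^ (m - i))"
    unfolding T_def poly_sum by (simp add: c_def poly_0_coeff_0[symmetric])
  also have "\<dots> = (\<Sum>i<n. poly.coeff R 0 ^ m)"
    by (intro sum.cong) (auto simp: power_add[symmetric] m)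
  finally have T0: "poly T 0 \<noteq> 0" using R0 n by simp
  have "\<exists>j. 0 < j \<and> j \<le> degree R \<and> poly.coeff (R ^ n) j \<noteq> 0"
  proof (rule ccontr)
    assume none: "\<not> ?thesis"
    have "poly.coeff (R ^ n - c ^ n) k = 0" if "k < Suc (degree R)" for k
    proof (cases "k = 0")
      case True
      then show ?thesis by (simp add: c_def poly_const_pow coeff_0_power)
    next
      case False
      then have "poly.coeff (R ^ n) k = 0" using none that unfolding less_Suc_eq_le by blast
      then show ?thesis using False by (cases k) (simp_all add: c_def poly_const_pow)
    qed
    then have "monom 1 (Suc (degree R)) dvd R ^ n - c ^ n"
      by (simp add: monom_1_dvd_iff')
    moreover have nz: "(R - c) * T \<noteq> 0" using T0 \<open>R \<noteq> c\<close> by auto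
    ultimately have "Suc (degree R) \<le> order 0 ((R - c) * T)"
      by (simp add: fact monom_1_dvd_iff)
    also have "\<dots> = order 0 (R - c)"
      using T0 order_root[of T 0] by (simp add: order_mult[OF nz])
    also have "\<dots> \<le> degree (R - c)"
      using \<open>R \<noteq> c\<close> by (simp add: order_degree)
    also have "\<dots> \<le> degree R"
      by (rule degree_diff_le) (simp_all add: c_def)
    finally show False by simp
  qed
  then show ?thesis using that by blast
qed

lemma power_coeff_near_top:
  fixes H :: "'k::field poly"
  assumes H0: "poly.coeff H 0 \<noteq> 0" and "degree H > 0" and n: "of_nat n \<noteq> (0::'k)"
  obtains j where "0 < j" "j \<le> degree H" "poly.coeff (H ^ n) (n * degree H - j) \<noteq> 0"
proof -
  have "poly.coeff (reflect_poly H) 0 \<noteq> 0" "degree (reflect_poly H) > 0"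
    using assms by auto
  then obtain j where j: "0 < j" "j \<le> degree H" "poly.coeff (reflect_poly H ^ n) j \<noteq> 0"
    using power_coeff_near_bottom[OF _ _ n] H0 by (metis degree_reflect_poly_eq)
  have "degree (H ^ n) = n * degree H"
    using H0 by (subst degree_power_eq) auto
  with j have "poly.coeff (H ^ n) (n * degree H - j) \<noteq> 0"
    by (simp add: reflect_poly_power[symmetric] coeff_reflect_poly split: if_splits)
  with j show ?thesis using that by blast
qed

section \<open>The coordinate ring inside \<open>K((1/x))[z]\<close>\<close>

definition x_elt :: "'k::field fls poly" where "x_elt = [:fls_X_inv:]"

definition z_elt :: "'k::field fls poly" where "z_elt = [:0, 1:]"

definition embX :: "'k::field poly \<Rightarrow> 'k fls" where
  "embX = eval_hom fls_const fls_X_inv"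

definition embXZ :: "'k::field poly poly \<Rightarrow> 'k fls poly" where
  "embXZ = eval_hom (\<lambda>p. [:embX p:]) z_elt"

definition y_elt :: "'k::field poly \<Rightarrow> 'k poly poly \<Rightarrow> 'k fls poly" where
  "y_elt f g = smult (inverse (embX f)) (embXZ g)"

definition embed :: "'k::field poly \<Rightarrow> 'k poly poly \<Rightarrow> 'k poly poly poly \<Rightarrow> 'k fls poly" where
  "embed f g = eval_hom embXZ (y_elt f g)"

lemma unital_hom_const: "unital_hom \<sigma> \<Longrightarrow> unital_hom (\<lambda>a. [:\<sigma> a:])"
  by (simp add: unital_hom_def one_pCons)

lemma unital_hom_fls_const: "unital_hom (fls_const :: 'k::field \<Rightarrow> 'k fls)"
  by (simp add: unital_hom_def fls_plus_const mult.commute)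

lemma unital_hom_embX: "unital_hom embX"
  unfolding embX_def by (intro unital_hom_eval_hom unital_hom_fls_const)

lemma unital_hom_embXZ: "unital_hom embXZ"
  unfolding embXZ_def by (intro unital_hom_eval_hom unital_hom_const unital_hom_embX)

lemma unital_hom_embed: "unital_hom (embed f g)"
  unfolding embed_def by (intro unital_hom_eval_hom unital_hom_embXZ)

lemma embed_pCons: "embed f g (pCons h p) = embXZ h + y_elt f g * embed f g p"
  unfolding embed_def by (rule eval_hom_pCons[OF unital_hom_embXZ])

lemma embXZ_pCons: "embXZ (pCons a h) = [:embX a:] + z_elt * embXZ h"
  unfolding embXZ_def by (rule eval_hom_pCons[OF unital_hom_const[OF unital_hom_embX]])

lemma embX_pCons: "embX (pCons c a) = fls_const c + fls_X_inv * embX a"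
  unfolding embX_def by (rule eval_hom_pCons[OF unital_hom_fls_const])

lemmas embX_simps = unital_homD[OF unital_hom_embX]
lemmas embXZ_simps = unital_homD[OF unital_hom_embXZ]
lemmas embed_simps = unital_homD[OF unital_hom_embed]

lemma embX_nth: "embX a $$ n = (if n \<le> 0 then poly.coeff a (nat (- n)) else 0)"
proof (induction a arbitrary: n)
  case (pCons c a)
  have "nat (- n) = Suc (nat (- (n + 1)))" if "n < 0" using that by simp
  then show ?case
    by (cases "n < 0") (auto simp: embX_pCons fls_X_inv_times_conv_shift pCons.IH)
qed (simp add: embX_simps)

lemma fls_subdegree_embX: "a \<noteq> 0 \<Longrightarrow> fls_subdegree (embX a) = - int (degree a)"
  by (rule fls_subdegree_eqI) (auto simp: embX_nth coeff_eq_0)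

lemma embX_eq_0_iff: "embX a = 0 \<longleftrightarrow> a = 0"
proof
  assume "embX a = 0"
  then have "embX a $$ (- int n) = 0" for n by simp
  then show "a = 0" by (simp add: embX_nth poly_eq_iff)
qed (simp add: embX_simps)

lemma coeff_embXZ: "poly.coeff (embXZ h) n = embX (poly.coeff h n)"
  by (induction h arbitrary: n)
     (simp_all add: embXZ_simps embX_simps embXZ_pCons z_elt_def coeff_pCons split: nat.split)

lemma degree_embXZ: "degree (embXZ h) = degree h"
  by (rule antisym; rule degree_le)
     (auto simp: coeff_embXZ coeff_eq_0 embX_simps embX_eq_0_iff[symmetric], metis coeff_embXZ coeff_eq_0)

lemma embXZ_eq_0_iff: "embXZ h = 0 \<longleftrightarrow> h = 0"
  by (simp add: poly_eq_iff coeff_embXZ embX_eq_0_iff)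

lemma val_embXZ: "h \<noteq> 0 \<Longrightarrow> val (embXZ h) = weight (int (degree (lead_coeff h))) (int (degree h))"
  by (simp add: val_def coeff_embXZ degree_embXZ fls_subdegree_embX)

lemma lead_scalar_embXZ: "lead_scalar (embXZ h) = lead_coeff (lead_coeff h)"
  by (cases "h = 0")
     (simp_all add: lead_scalar_def coeff_embXZ degree_embXZ fls_subdegree_embX embX_nth embXZ_simps)

lemma y_elt_conv_mult: "y_elt f g = [:inverse (embX f):] * embXZ g"
  by (simp add: y_elt_def)

lemma val_const_poly: "val [:a:] = weight (- fls_subdegree a) 0"
  by (simp add: val_def)

lemma lead_scalar_const_poly: "lead_scalar [:a:] = a $$ fls_subdegree a"
  by (simp add: lead_scalar_def)

lemma lead_scalar_inverse:
  "lead_scalar [:inverse a:] = inverse (lead_scalar [:a:])" for a :: "'k::field fls"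
proof (cases "a = 0")
  case False
  then have "lead_scalar [:inverse a:] * lead_scalar [:a:] = lead_scalar 1"
    by (simp add: lead_scalar_mult[symmetric] one_pCons)
  also have "\<dots> = 1" by (simp add: lead_scalar_def)
  finally show ?thesis by (metis inverse_unique mult.commute)
qed (simp add: lead_scalar_def)

lemma embed_surface_rel:
  assumes "f \<noteq> 0"
  shows "embed f g (surface_rel f g) = 0"
  using assms
  by (simp add: surface_rel_def varY_def embed_simps embed_pCons embXZ_pCons y_elt_conv_mult
      embXZ_simps embX_simps embX_eq_0_iff)

context
  fixes f :: "'k::field poly" and g :: "'k poly poly"
  assumes lead_f: "lead_coeff f = 1" and deg_f: "degree f \<ge> 2"
    and lead_g: "lead_coeff g = 1" and deg_g: "degree g \<ge> 2"
begin

lemma f_nz: "f \<noteq> 0" and g_nz: "g \<noteq> 0"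
  using deg_f deg_g by auto

lemma val_y: "val (y_elt f g) = weight (- int (degree f)) (int (degree g))"
  using f_nz g_nz lead_g
  by (simp add: y_elt_conv_mult val_mult embX_eq_0_iff embXZ_eq_0_iff val_const_poly val_embXZ
      fls_subdegree_embX weight_add del: mult_pCons_left)

lemma lead_scalar_y: "lead_scalar (y_elt f g) = 1"
proof -
  have "lead_scalar [:embX f:] = 1"
    using lead_f f_nz by (simp add: lead_scalar_const_poly fls_subdegree_embX embX_nth)
  then show ?thesis
    using lead_g unfolding y_elt_conv_mult lead_scalar_mult lead_scalar_inverse
    by (simp add: lead_scalar_embXZ)
qed

text \<open>
  Representatives whose coefficients, as polynomials in \<open>Z\<close>, have degree below that of \<open>g\<close>. For them the
  powers of \<open>Y\<close> contribute leading terms with distinct degrees in \<open>z\<close>, so nothing cancels.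
\<close>

definition reduced :: "'k poly poly poly \<Rightarrow> bool" where
  "reduced q \<longleftrightarrow> (\<forall>k. degree (poly.coeff q k) < degree g)"

lemma reduced_add: "reduced p \<Longrightarrow> reduced q \<Longrightarrow> reduced (p + q)"
  by (auto simp: reduced_def intro: degree_add_less)

lemma reduced_pCons: "reduced (pCons h q) \<longleftrightarrow> degree h < degree g \<and> reduced q"
  by (auto simp: reduced_def coeff_pCons split: nat.splits)

lemma reduced_0: "reduced 0"
  using deg_g by (simp add: reduced_def)

lemma reduced_smult: "reduced q \<Longrightarrow> reduced (smult [:a:] q)"
  unfolding reduced_def by (auto intro: le_less_trans[OF degree_smult_le])

lemma monic_division:
  obtains a b where "h = g * a + b" "degree b < degree g" "degree h \<ge> degree g \<Longrightarrow> degree a < degree h"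
proof -
  obtain a b where ab: "pseudo_divmod h g = (a, b)" by (cases "pseudo_divmod h g")
  have h: "h = g * a + b"
    using pseudo_divmod(1)[OF g_nz ab] lead_g by simp
  have b: "degree b < degree g"
    using pseudo_divmod(2)[OF g_nz ab] deg_g by auto
  have "degree a < degree h" if le: "degree h \<ge> degree g"
  proof (cases "a = 0")
    case False
    then have "degree (g * a) = degree g + degree a"
      using g_nz by (simp add: degree_mult_eq)
    then have "degree h = degree g + degree a"
      using h b by (metis add.commute degree_add_eq_right le_add1 less_le_trans)
    then show ?thesis using deg_g by simp
  qed (use le deg_g in simp)
  then show ?thesis using that h b by blast
qed

text \<open>
  Division by \<open>g\<close> rewrites \<open>h = g a + b\<close> as \<open>f Y a + b\<close>, which trades degree in \<open>Z\<close> for powers of \<open>Y\<close>.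
\<close>

lemma reduced_form_const: "\<exists>q. reduced q \<and> surface_rel f g dvd [:h:] - q"
proof (induction "degree h" arbitrary: h rule: less_induct)
  case less
  obtain a b where ab: "h = g * a + b" "degree b < degree g"
    "degree h \<ge> degree g \<Longrightarrow> degree a < degree h"
    using monic_division by blast
  show ?case
  proof (cases "degree h < degree g")
    case True
    then show ?thesis
      using reduced_0 by (intro exI[of _ "[:h:]"]) (simp add: reduced_pCons)
  next
    case False
    then obtain q where q: "reduced q" "surface_rel f g dvd [:a:] - q"
      using less ab(3) by force
    have "[:h:] - (pCons b (smult [:f:] q)) =
        [:[:f:]:] * varY * ([:a:] - q) - surface_rel f g * [:a:]"
      by (simp add: surface_rel_def varY_def ab(1) smult_diff_right)
    moreover have "surface_rel f g dvd \<dots>"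
      by (rule dvd_diff[OF dvd_mult[OF q(2)] dvd_triv_left])
    moreover have "reduced (pCons b (smult [:f:] q))"
      using q ab by (simp add: reduced_pCons reduced_smult)
    ultimately show ?thesis by metis
  qed
qed

lemma reduced_form: "\<exists>q. reduced q \<and> surface_rel f g dvd p - q"
proof (induction p)
  case (pCons h p)
  then obtain q where q: "reduced q" "surface_rel f g dvd p - q" by blast
  obtain q' where q': "reduced q'" "surface_rel f g dvd [:h:] - q'"
    using reduced_form_const by blast
  have "pCons h p - (q' + pCons 0 q) = ([:h:] - q') + varY * (p - q)"
    by (simp add: varY_def)
  moreover have "surface_rel f g dvd \<dots>"
    using q q' by (intro dvd_add dvd_mult)
  moreover have "reduced (q' + pCons 0 q)"
    using q q' deg_g by (intro reduced_add) (auto simp: reduced_pCons)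
  ultimately show ?case by metis
qed (use reduced_0 in auto)

text \<open>
  The degree in \<open>z\<close> of the \<open>k\<close>-th summand lies in \<open>[d k, d k + d)\<close> where \<open>d\<close> is the degree of \<open>g\<close>, so the
  top summand determines the value, and multiplication by \<open>y\<close> shifts it by \<open>v(y)\<close>.
\<close>

lemma val_reduced:
  assumes "reduced q" "q \<noteq> 0"
  shows "embed f g q \<noteq> 0 \<and> (\<exists>i k j. val (embed f g q) =
    weight (int i - int (degree f) * int k) (int (degree g) * int k + int j))"
  using assms
proof (induction q)
  case (pCons h q)
  let ?y = "y_elt f g"
  have dh: "degree h < degree g" and q: "reduced q"
    using pCons.prems by (simp_all add: reduced_pCons)
  show ?case
  proof (cases "q = 0")
    case True
    then have "h \<noteq> 0" using pCons.prems by simp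
    then have "embed f g (pCons h q) \<noteq> 0" "val (embed f g (pCons h q)) =
        weight (int (degree (lead_coeff h)) - int (degree f) * int 0)
          (int (degree g) * int 0 + int (degree h))"
      using True by (simp_all add: embed_pCons embed_simps embXZ_eq_0_iff val_embXZ)
    then show ?thesis by blast
  next
    case False
    then obtain i k j where nz: "embed f g q \<noteq> 0" and v: "val (embed f g q) =
        weight (int i - int (degree f) * int k) (int (degree g) * int k + int j)"
      using pCons.IH q by blast
    have ynz: "?y \<noteq> 0" using lead_scalar_y by (metis lead_scalar_eq_0_iff zero_neq_one)
    have v': "val (?y * embed f g q) =
        weight (int i - int (degree f) * int (Suc k)) (int (degree g) * int (Suc k) + int j)"
      using nz ynz by (simp add: val_mult v val_y weight_add algebra_simps)
    have "int (degree h) < int (degree g) * 1" using dh by simp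
    also have "\<dots> \<le> int (degree g) * int (Suc k)" by (intro mult_left_mono) auto
    also have "\<dots> \<le> int (degree g) * int (Suc k) + int j" by simp
    finally have "embXZ h = 0 \<or> val (embXZ h) < val (?y * embed f g q)"
      by (cases "h = 0") (simp_all add: embXZ_simps val_embXZ v' weight_less_iff)
    then have "val (embed f g (pCons h q)) = val (?y * embed f g q)"
      "lead_scalar (embed f g (pCons h q)) = lead_scalar (?y * embed f g q)"
      unfolding embed_pCons using nz ynz by (auto intro!: val_add_less)
    then show ?thesis
      using nz ynz v' by (metis lead_scalar_eq_0_iff mult_eq_0_iff)
  qed
qed simp

text \<open>
  By \<open>val_reduced\<close> a nonzero reduced polynomial has a nonzero image, so the reduced form of an element
  of the kernel is 0.
\<close>

lemma embed_eq_0_iff: "embed f g p = 0 \<longleftrightarrow> surface_rel f g dvd p"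
proof
  assume 0: "embed f g p = 0"
  obtain q where q: "reduced q" "surface_rel f g dvd p - q"
    using reduced_form by blast
  then obtain t where "p - q = surface_rel f g * t" by (auto elim: dvdE)
  then have "embed f g (p - q) = 0"
    using embed_surface_rel[OF f_nz] by (simp only: embed_simps(3)) simp
  then have "embed f g q = 0" using 0 by (simp add: embed_simps)
  then have "q = 0" using val_reduced q by blast
  then show "surface_rel f g dvd p" using q by simp
next
  assume "surface_rel f g dvd p"
  then show "embed f g p = 0"
    using embed_surface_rel[OF f_nz] by (auto simp: embed_simps elim!: dvdE)
qed

lemma val_embed:
  assumes "embed f g p \<noteq> 0"
  shows "\<exists>i k j. val (embed f g p) =
    weight (int i - int (degree f) * int k) (int (degree g) * int k + int j)"
proof -
  obtain q where q: "reduced q" "surface_rel f g dvd p - q"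
    using reduced_form by blast
  then have "embed f g p = embed f g q"
    using embed_eq_0_iff[of "p - q"] by (simp add: embed_simps)
  then show ?thesis using assms q val_reduced[of q] by (cases "q = 0") (auto simp: embed_simps)
qed

end

section \<open>Exponential maps degenerate to monomials\<close>

text \<open>
  The data that the degeneration argument needs: a subring \<open>B\<close> of \<open>K((1/x))[z]\<close> whose values are those
  of monomials in \<open>x\<close>, \<open>y\<close>, \<open>z\<close>, and an exponential map on it, given by its coefficient operators.
\<close>

locale exponential_subring =
  fixes B :: "'k::field fls poly set" and y :: "'k fls poly" and r d :: nat
    and \<Phi> :: "'k fls poly \<Rightarrow> 'k fls poly poly"
  assumes r_ge: "r \<ge> 2" and d_ge: "d \<ge> 2"
    and scal_in: "scal c \<in> B" and x_in: "x_elt \<in> B" and y_in: "y \<in> B" and z_in: "z_elt \<in> B"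
    and add_in: "a \<in> B \<Longrightarrow> b \<in> B \<Longrightarrow> a + b \<in> B"
    and mult_in: "a \<in> B \<Longrightarrow> b \<in> B \<Longrightarrow> a * b \<in> B"
    and val_y: "val y = weight (- int r) (int d)" and lead_scalar_y: "lead_scalar y = 1"
    and val_in: "b \<in> B \<Longrightarrow> b \<noteq> 0 \<Longrightarrow>
      \<exists>i k j. val b = weight (int i - int r * int k) (int d * int k + int j)"
    and Phi_scal: "\<Phi> (scal c) = [:scal c:]"
    and Phi_add: "a \<in> B \<Longrightarrow> b \<in> B \<Longrightarrow> \<Phi> (a + b) = \<Phi> a + \<Phi> b"
    and Phi_mult: "a \<in> B \<Longrightarrow> b \<in> B \<Longrightarrow> \<Phi> (a * b) = \<Phi> a * \<Phi> b"
    and coeff_Phi_in: "b \<in> B \<Longrightarrow> poly.coeff (\<Phi> b) i \<in> B"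
    and coeff_Phi_0: "b \<in> B \<Longrightarrow> poly.coeff (\<Phi> b) 0 = b"
    and Phi_Phi: "b \<in> B \<Longrightarrow> poly.coeff (\<Phi> (poly.coeff (\<Phi> b) i)) j =
      of_nat ((i + j) choose i) * poly.coeff (\<Phi> b) (i + j)"
begin

abbreviation "x \<equiv> x_elt :: 'k fls poly"
abbreviation "z \<equiv> z_elt :: 'k fls poly"

definition monomial :: "nat \<Rightarrow> nat \<Rightarrow> nat \<Rightarrow> 'k fls poly" where
  "monomial i k j = x ^ i * y ^ k * z ^ j"

lemma val_x: "val x = weight 1 0"
  and val_z: "val z = weight 0 1"
  and lead_scalar_x: "lead_scalar x = 1"
  and lead_scalar_z: "lead_scalar z = 1"
  by (simp_all add: val_def lead_scalar_def x_elt_def z_elt_def)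

lemma x_nz [simp]: "x \<noteq> 0" and z_nz [simp]: "z \<noteq> 0"
  and y_nz [simp]: "y \<noteq> 0"
  using lead_scalar_x lead_scalar_z lead_scalar_y
  by (metis lead_scalar_eq_0_iff zero_neq_one)+

lemma scal_1: "scal 1 = (1 :: 'k fls poly)"
  using unital_homD(1)[OF unital_hom_scal] .

lemma scal_0: "scal 0 = (0 :: 'k fls poly)"
  using unital_homD(4)[OF unital_hom_scal] .

lemma one_in: "1 \<in> B"
  using scal_in[of 1] by (simp add: scal_1)

lemma Phi_0: "\<Phi> 0 = 0" and Phi_1: "\<Phi> 1 = 1"
  using Phi_scal[of 0] Phi_scal[of 1] by (simp_all add: scal_0 scal_1 one_pCons)

lemma power_in: "b \<in> B \<Longrightarrow> b ^ n \<in> B"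
  by (induction n) (simp_all add: one_in mult_in)

lemma monomial_in: "monomial i k j \<in> B"
  by (simp add: monomial_def mult_in power_in x_in y_in z_in)

lemma monomial_nz [simp]: "monomial i k j \<noteq> 0"
  by (simp add: monomial_def)

lemma val_1: "val (1 :: 'k fls poly) = weight 0 0"
  by (simp add: val_def)

lemma val_one: "val (1 :: 'k fls poly) = 0"
  by (simp add: val_1 weight_def)

lemma val_power: "b \<noteq> 0 \<Longrightarrow> val b = weight m n \<Longrightarrow> val (b ^ i) = weight (int i * m) (int i * n)"
  for b :: "'k fls poly"
  by (induction i) (simp_all add: val_1 val_mult weight_add algebra_simps)

lemma val_monomial: "val (monomial i k j) = weight (int i - int r * int k) (int d * int k + int j)"
  by (simp add: monomial_def val_mult val_power[OF _ val_x] val_power[OF _ val_y]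
      val_power[OF _ val_z] weight_add algebra_simps)

lemma lead_scalar_1: "lead_scalar (1 :: 'k fls poly) = 1"
  by (simp add: lead_scalar_def)

lemma lead_scalar_power: "lead_scalar (b ^ n) = lead_scalar b ^ n" for b :: "'k fls poly"
  by (induction n) (simp_all add: lead_scalar_1 lead_scalar_mult)

lemma lead_scalar_monomial: "lead_scalar (monomial i k j) = 1"
  by (simp add: monomial_def lead_scalar_mult lead_scalar_power lead_scalar_x lead_scalar_y
      lead_scalar_z)

lemma subtract_leading_term:
  assumes b: "b \<in> B" "b \<noteq> 0" and m: "m \<in> B" "val b = val m" "lead_scalar m = 1"
  obtains b' where "b' \<in> B" "b = scal (lead_scalar b) * m + b'" "b' = 0 \<or> val b' < val b"
proof -
  define t where "t = scal (- lead_scalar b) * m"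
  have nz: "m \<noteq> 0" "t \<noteq> 0"
    using m b by (auto simp: t_def lead_scalar_def)
  have "val t = val b" "lead_scalar t = - lead_scalar b"
    using nz m b by (auto simp: t_def val_mult val_scal lead_scalar_mult lead_scalar_scal)
  then have "b + t = 0 \<or> val (b + t) < val b"
    using val_add_same(3)[of b t] b nz by simp
  moreover have "b + t \<in> B"
    unfolding t_def by (intro add_in mult_in scal_in b m)
  moreover have "b = scal (lead_scalar b) * m + (b + t)"
    by (simp add: t_def unital_homD(5)[OF unital_hom_scal])
  ultimately show ?thesis using that by blast
qed

text \<open>
  Subtracting the monomial with the same leading term lowers the value, and values of elements of
  \<open>B\<close> are well-founded: the degree in \<open>z\<close> is at least \<open>k\<close>, so the degree in \<open>x\<close>, which is \<open>i - r k\<close>, is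
  bounded below by \<open>- r\<close> times the degree in \<open>z\<close>.
\<close>

lemma subring_induct [consumes 1, case_names zero add]:
  assumes "b \<in> B" and zero: "P 0"
    and add: "\<And>c i k j b. c \<noteq> 0 \<Longrightarrow> b \<in> B \<Longrightarrow> b = 0 \<or> val b < val (monomial i k j) \<Longrightarrow> P b \<Longrightarrow>
      P (scal c * monomial i k j + b)"
  shows "P b"
  using \<open>b \<in> B\<close>
proof (induction b rule: wf_induct_rule[OF wf_measures[of
    "[degree, \<lambda>b. nat (int r * int (degree b) - fls_subdegree (lead_coeff b))]"]])
  case (1 b)
  show ?case
  proof (cases "b = 0")
    case False
    have pos: "int r * int (degree a) - fls_subdegree (lead_coeff a) \<ge> 0" if a_in: "a \<in> B" "a \<noteq> 0" for a
    proof -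
      obtain i k j where "val a = weight (int i - int r * int k) (int d * int k + int j)"
        using val_in a_in by blast
      then have a: "- fls_subdegree (lead_coeff a) = int i - int r * int k"
        "int (degree a) = int d * int k + int j"
        by (simp_all add: val_def weight_eq_iff)
      have "int d * int k \<ge> 1 * int k" using d_ge by (intro mult_right_mono) auto
      then have "int (degree a) \<ge> int k" using a by simp
      then have "int r * int (degree a) \<ge> int r * int k" by (rule mult_left_mono) simp
      then show ?thesis using a by simp
    qed
    obtain i k j where v: "val b = val (monomial i k j)"
      using val_in[OF \<open>b \<in> B\<close> False] by (auto simp: val_monomial)
    obtain b' where b': "b' \<in> B" "b = scal (lead_scalar b) * monomial i k j + b'"
      "b' = 0 \<or> val b' < val b"
      using subtract_leading_term[OF \<open>b \<in> B\<close> False monomial_in v lead_scalar_monomial] by blast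
    have "P b'"
    proof (cases "b' = 0")
      case b'_nz: False
      then have "val b' < val b" using b' by simp
      then have "(b', b) \<in> measures [degree, \<lambda>b. nat (int r * int (degree b) - fls_subdegree (lead_coeff b))]"
        using pos[OF \<open>b' \<in> B\<close> b'_nz] by (auto simp: val_def weight_less_iff)
      then show ?thesis using 1(1) b' by blast
    qed (simp add: zero)
    then show ?thesis
      using add[of "lead_scalar b" b' i k j] b' v False by simp
  qed (simp add: zero)
qed

end

text \<open>
  The weight \<open>\<mu>\<close> of \<open>U\<close> is the least slope \<open>(v(g) - v(D_i g)) / i\<close> over the generators \<open>g\<close> and all \<open>i \<ge> 1\<close>
  with \<open>D_i g \<noteq> 0\<close>. It makes every \<open>D_i\<close> lower values by at least \<open>i \<mu>\<close>, and it leaves a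
  nonconstant symbol for at least one generator.
\<close>

locale exponential_slope = exponential_subring B y r d \<Phi>
  for B :: "'k::field fls poly set" and y r d \<Phi> +
  fixes \<mu> :: "rat poly"
  assumes slope: "g \<in> {x, y, z} \<Longrightarrow> below (val g - of_nat i * \<mu>) (poly.coeff (\<Phi> g) i)"
    and slope_attained: "\<exists>g\<in>{x, y, z}. \<exists>i\<ge>1. poly.coeff (\<Phi> g) i \<noteq> 0 \<and>
      val (poly.coeff (\<Phi> g) i) = val g - of_nat i * \<mu>"
begin

definition bounded :: "rat poly \<Rightarrow> 'k fls poly \<Rightarrow> bool" where
  "bounded \<gamma> b \<longleftrightarrow> (\<forall>i. below (\<gamma> - of_nat i * \<mu>) (poly.coeff (\<Phi> b) i))"

text \<open>
  The leading form of \<open>\<phi>(b)\<close> when \<open>b\<close> is placed in weight \<open>\<gamma>\<close> and \<open>U\<close> has weight \<open>\<mu>\<close>.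
\<close>

definition symbol_at :: "rat poly \<Rightarrow> 'k fls poly \<Rightarrow> 'k poly" where
  "symbol_at \<gamma> b = (\<Sum>i\<le>degree (\<Phi> b). monom (lead_at (\<gamma> - of_nat i * \<mu>) (poly.coeff (\<Phi> b) i)) i)"

lemma coeff_symbol_at:
  "poly.coeff (symbol_at \<gamma> b) i = lead_at (\<gamma> - of_nat i * \<mu>) (poly.coeff (\<Phi> b) i)"
  by (simp add: symbol_at_def coeff_sum if_distrib coeff_eq_0 cong: if_cong)

lemma bounded_mono: "bounded \<gamma> b \<Longrightarrow> \<gamma> \<le> \<delta> \<Longrightarrow> bounded \<delta> b"
  unfolding bounded_def by (meson below_mono diff_right_mono)

lemma bounded_add: "a \<in> B \<Longrightarrow> b \<in> B \<Longrightarrow> bounded \<gamma> a \<Longrightarrow> bounded \<gamma> b \<Longrightarrow> bounded \<gamma> (a + b)"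
  by (simp add: bounded_def Phi_add below_add)

lemma weight_split:
  assumes "j \<le> i"
  shows "\<gamma> + \<delta> - of_nat i * \<mu> = (\<gamma> - of_nat j * \<mu>) + (\<delta> - of_nat (i - j) * \<mu>)"
  using assms by (simp add: of_nat_diff algebra_simps)

lemma below_product_term:
  assumes "bounded \<gamma> a" "bounded \<delta> b" "j \<le> i"
  shows "below (\<gamma> + \<delta> - of_nat i * \<mu>) (poly.coeff (\<Phi> a) j * poly.coeff (\<Phi> b) (i - j))"
  unfolding weight_split[OF assms(3)]
  using assms(1,2) unfolding bounded_def by (intro below_mult) blast+

lemma bounded_mult:
  assumes "a \<in> B" "b \<in> B" "bounded \<gamma> a" "bounded \<delta> b"
  shows "bounded (\<gamma> + \<delta>) (a * b)"
  unfolding bounded_def Phi_mult[OF assms(1,2)] coeff_mult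
  using below_product_term[OF assms(3,4)] by (auto intro: below_sum)

lemma symbol_at_mult:
  assumes "a \<in> B" "b \<in> B" "bounded \<gamma> a" "bounded \<delta> b"
  shows "symbol_at (\<gamma> + \<delta>) (a * b) = symbol_at \<gamma> a * symbol_at \<delta> b"
proof (rule poly_eqI)
  fix i
  have "poly.coeff (symbol_at (\<gamma> + \<delta>) (a * b)) i =
      (\<Sum>j\<le>i. lead_at (\<gamma> + \<delta> - of_nat i * \<mu>) (poly.coeff (\<Phi> a) j * poly.coeff (\<Phi> b) (i - j)))"
    unfolding coeff_symbol_at Phi_mult[OF assms(1,2)] coeff_mult
    using below_product_term[OF assms(3,4)] by (intro lead_at_sum) auto
  also have "\<dots> = (\<Sum>j\<le>i. poly.coeff (symbol_at \<gamma> a) j * poly.coeff (symbol_at \<delta> b) (i - j))"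
  proof (intro sum.cong refl)
    fix j assume "j \<in> {..i}"
    then have "j \<le> i" by simp
    show "lead_at (\<gamma> + \<delta> - of_nat i * \<mu>) (poly.coeff (\<Phi> a) j * poly.coeff (\<Phi> b) (i - j)) =
        poly.coeff (symbol_at \<gamma> a) j * poly.coeff (symbol_at \<delta> b) (i - j)"
      unfolding weight_split[OF \<open>j \<le> i\<close>] coeff_symbol_at
      using assms(3,4) unfolding bounded_def by (intro lead_at_mult) blast+
  qed
  finally show "poly.coeff (symbol_at (\<gamma> + \<delta>) (a * b)) i = poly.coeff (symbol_at \<gamma> a * symbol_at \<delta> b) i"
    by (simp add: coeff_mult)
qed

lemma symbol_at_add:
  "a \<in> B \<Longrightarrow> b \<in> B \<Longrightarrow> bounded \<gamma> a \<Longrightarrow> bounded \<gamma> b \<Longrightarrow>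
    symbol_at \<gamma> (a + b) = symbol_at \<gamma> a + symbol_at \<gamma> b"
  by (rule poly_eqI) (simp add: coeff_symbol_at Phi_add bounded_def lead_at_add)

lemma symbol_at_eq_0_if_less: "bounded \<gamma> b \<Longrightarrow> \<gamma> < \<delta> \<Longrightarrow> symbol_at \<delta> b = 0"
  by (rule poly_eqI)
     (auto simp: coeff_symbol_at bounded_def intro!: lead_at_eq_0_if_less diff_strict_right_mono)

lemma bounded_scal: "bounded 0 (scal c)"
  by (auto simp: bounded_def Phi_scal coeff_pCons below_def val_scal split: nat.split)

lemma symbol_at_scal: "symbol_at 0 (scal c) = [:c:]"
  by (rule poly_eqI)
     (auto simp: coeff_symbol_at Phi_scal coeff_pCons lead_at_def val_scal lead_scalar_scal
       split: nat.split)

lemma bounded_generators: "bounded (val x) x" "bounded (val y) y" "bounded (val z) z"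
  using slope by (auto simp: bounded_def)

lemma bounded_power:
  assumes "b \<in> B" "b \<noteq> 0" "bounded (val b) b"
  shows "bounded (val (b ^ n)) (b ^ n)"
proof (induction n)
  case 0
  show ?case using bounded_scal[of 1] by (simp add: scal_1 val_1 weight_def)
next
  case (Suc n)
  have "bounded (val b + val (b ^ n)) (b * b ^ n)"
    by (rule bounded_mult[OF assms(1) power_in[OF assms(1)] assms(3) Suc.IH])
  then show ?case using assms by (simp add: val_mult)
qed

lemma bounded_monomial: "bounded (val (monomial i k j)) (monomial i k j)"
proof -
  have "bounded (val (x ^ i) + val (y ^ k) + val (z ^ j)) (x ^ i * y ^ k * z ^ j)"
    by (intro bounded_mult bounded_power mult_in power_in x_in y_in z_in x_nz y_nz z_nz
        bounded_generators)
  then show ?thesis by (simp add: monomial_def val_mult)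
qed

text \<open>
  By \<open>subring_induct\<close> it suffices to bound monomials: in a sum produced there the leading monomial
  has the value of the whole sum, so no cancellation interferes.
\<close>

lemma bounded_val: "b \<in> B \<Longrightarrow> bounded (val b) b"
proof (induction rule: subring_induct)
  case zero
  then show ?case by (simp add: bounded_def Phi_0)
next
  case (add c i k j b)
  have 1: "bounded (0 + val (monomial i k j)) (scal c * monomial i k j)"
    by (intro bounded_mult scal_in monomial_in bounded_scal bounded_monomial)
  have nz: "scal c * monomial i k j \<noteq> 0" using add by simp
  have v: "val (scal c * monomial i k j) = val (monomial i k j)"
    using add by (simp add: val_mult val_scal)
  have "bounded (val (monomial i k j)) b"
  proof (cases "b = 0")
    case True
    then show ?thesis by (simp add: bounded_def Phi_0)
  next
    case False
    then show ?thesis using add by (auto intro: bounded_mono)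
  qed
  with 1 have "bounded (val (monomial i k j)) (scal c * monomial i k j + b)"
    using add by (intro bounded_add mult_in scal_in monomial_in) auto
  moreover have "val (scal c * monomial i k j + b) = val (monomial i k j)"
    using val_add_less(1)[OF nz, of b] add v by (simp add: add.commute)
  ultimately show ?case by simp
qed

definition symbol :: "'k fls poly \<Rightarrow> 'k poly" where
  "symbol b = symbol_at (val b) b"

lemma symbol_mult:
  "a \<in> B \<Longrightarrow> b \<in> B \<Longrightarrow> a \<noteq> 0 \<Longrightarrow> b \<noteq> 0 \<Longrightarrow> symbol (a * b) = symbol a * symbol b"
  by (simp add: symbol_def val_mult symbol_at_mult bounded_val)

lemma symbol_power:
  assumes "b \<in> B" "b \<noteq> 0"
  shows "symbol (b ^ n) = symbol b ^ n"
proof (induction n)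
  case 0
  show ?case using symbol_at_scal[of 1] by (simp add: symbol_def scal_1 val_one flip: one_pCons)
qed (use assms in \<open>simp add: symbol_mult power_in\<close>)

text \<open>
  The two elements differ, after scaling, by something of smaller value, whose leading form in the
  given weight is 0.
\<close>

lemma symbol_same_val:
  assumes "b \<in> B" "b \<noteq> 0" "m \<in> B" "val b = val m" "lead_scalar m = 1"
  shows "symbol b = smult (lead_scalar b) (symbol m)"
proof -
  obtain b' where b': "b' \<in> B" "b = scal (lead_scalar b) * m + b'" "b' = 0 \<or> val b' < val b"
    using subtract_leading_term[OF assms] by blast
  let ?t = "scal (lead_scalar b) * m"
  have t: "?t \<in> B" using assms by (intro mult_in scal_in)
  have bt: "bounded (0 + val m) ?t"
    using assms by (intro bounded_mult scal_in bounded_scal bounded_val)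
  have low: "bounded (val m) b' \<and> symbol_at (val m) b' = 0"
  proof (cases "b' = 0")
    case True
    then show ?thesis by (simp add: bounded_def Phi_0 symbol_at_def)
  next
    case False
    then show ?thesis
      using b' assms bounded_val[of b'] symbol_at_eq_0_if_less[of "val b'" b' "val m"]
      by (auto intro: bounded_mono)
  qed
  have "symbol b = symbol_at (val m) (?t + b')"
    using b'(2) assms by (simp add: symbol_def)
  also have "\<dots> = symbol_at (0 + val m) ?t"
    using bt low t b'(1) by (simp add: symbol_at_add)
  also have "\<dots> = [:lead_scalar b:] * symbol_at (val m) m"
    using assms by (subst symbol_at_mult) (simp_all add: scal_in bounded_scal bounded_val symbol_at_scal)
  finally show ?thesis by (simp add: symbol_def)
qed

lemma coeff_0_symbol: "b \<in> B \<Longrightarrow> poly.coeff (symbol b) 0 = lead_scalar b"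
  by (simp add: symbol_def coeff_symbol_at coeff_Phi_0 lead_at_def)

lemma symbol_nz: "b \<in> B \<Longrightarrow> b \<noteq> 0 \<Longrightarrow> symbol b \<noteq> 0"
  using coeff_0_symbol by (metis coeff_0 lead_scalar_eq_0_iff)

definition "p = degree (symbol x)"
definition "l = degree (symbol y)"
definition "q = degree (symbol z)"

lemma symbol_monomial:
  "symbol (monomial i k j) = symbol x ^ i * symbol y ^ k * symbol z ^ j"
  by (simp add: monomial_def symbol_mult symbol_power x_in y_in z_in power_in mult_in)

lemma degree_symbol:
  assumes "b \<in> B" "b \<noteq> 0" "val b = val (monomial i k j)"
  shows "degree (symbol b) = i * p + k * l + j * q"
  using symbol_same_val[OF assms(1,2) monomial_in assms(3) lead_scalar_monomial]
    symbol_nz[OF x_in x_nz] symbol_nz[OF y_in y_nz] symbol_nz[OF z_in z_nz] assms(2)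
  by (simp add: symbol_monomial degree_mult_eq degree_power_eq p_def l_def q_def)

text \<open>
  The monomials \<open>x^r y\<close> and \<open>z^d\<close> have the same value and leading scalar 1, so their symbols agree.
\<close>

lemma symbol_relation: "symbol x ^ r * symbol y = symbol z ^ d"
proof -
  have "val (monomial r 1 0) = val (monomial 0 0 d)" by (simp add: val_monomial)
  from symbol_same_val[OF monomial_in monomial_nz monomial_in this lead_scalar_monomial]
  show ?thesis by (simp add: symbol_monomial lead_scalar_monomial)
qed

lemma degree_relation: "r * p + l = d * q"
  using arg_cong[OF symbol_relation, of degree]
    symbol_nz[OF x_in x_nz] symbol_nz[OF y_in y_nz] symbol_nz[OF z_in z_nz]
  by (simp add: degree_mult_eq degree_power_eq p_def l_def q_def)

text \<open>
  The linear extension to all weights of the degree of the symbol, as a function of the value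
  (\<open>udeg_val\<close>). The relation \<open>r p + l = d q\<close> makes it consistent on the value of \<open>y\<close>.
\<close>

definition udeg :: "rat poly \<Rightarrow> rat" where
  "udeg \<gamma> = poly.coeff \<gamma> 1 * of_nat q + poly.coeff \<gamma> 0 * of_nat p"

lemma udeg_diff: "udeg (\<gamma> - of_nat t * \<delta>) = udeg \<gamma> - of_nat t * udeg \<delta>"
  by (simp add: udeg_def of_nat_poly algebra_simps)

lemma udeg_monomial: "udeg (val (monomial i k j)) = of_nat (i * p + k * l + j * q)"
proof -
  have "of_nat l = (of_nat d * of_nat q - of_nat r * of_nat p :: rat)"
    using arg_cong[OF degree_relation, of "of_nat :: nat \<Rightarrow> rat"] by (simp add: algebra_simps)
  then have "of_nat (i * p + k * l + j * q) = (of_nat i * of_nat p +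
      of_nat k * (of_nat d * of_nat q - of_nat r * of_nat p) + of_nat j * of_nat q :: rat)"
    by simp
  then show ?thesis by (simp add: udeg_def val_monomial weight_def algebra_simps)
qed

lemma udeg_val:
  assumes "b \<in> B" "b \<noteq> 0"
  shows "udeg (val b) = of_nat (degree (symbol b))"
proof -
  obtain i k j where "val b = val (monomial i k j)"
    using val_in[OF assms] by (auto simp: val_monomial)
  then show ?thesis using degree_symbol[OF assms] udeg_monomial by simp
qed

text \<open>
  The coefficient is the leading scalar of \<open>c = D_t(b)\<close>, which therefore has value \<open>v(b) - t \<mu>\<close>. By the
  composition law the symbol of \<open>c\<close> consists of the coefficients of the symbol of \<open>b\<close> from place
  \<open>t\<close> on, multiplied by binomial coefficients; for \<open>t\<close> the degree it is constant.
\<close>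

lemma coefficient_of_symbol:
  assumes "b \<in> B" "b \<noteq> 0" and t: "poly.coeff (symbol b) t \<noteq> 0"
  obtains i k j where "val b - of_nat t * \<mu> = val (monomial i k j)"
    "t = degree (symbol b) \<Longrightarrow> i * p + k * l + j * q = 0"
proof -
  define c where "c = poly.coeff (\<Phi> b) t"
  have c: "c \<in> B" "c \<noteq> 0" and v: "val c = val b - of_nat t * \<mu>"
    using t assms(1) by (auto simp: symbol_def coeff_symbol_at c_def coeff_Phi_in lead_at_def
        split: if_splits)
  have of_nat_scal: "(of_nat n :: 'k fls poly) = scal (of_nat n)" for n
    by (simp add: scal_def of_nat_poly fls_of_nat)
  have "poly.coeff (symbol c) s = of_nat ((t + s) choose t) * poly.coeff (symbol b) (t + s)" for s
  proof -
    have "poly.coeff (symbol c) s = lead_at (val b - of_nat (t + s) * \<mu>) (poly.coeff (\<Phi> c) s)"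
      by (simp add: symbol_def coeff_symbol_at v algebra_simps)
    also have "poly.coeff (\<Phi> c) s = scal (of_nat ((t + s) choose t)) * poly.coeff (\<Phi> b) (t + s)"
      using Phi_Phi[OF assms(1), of t s] by (simp only: c_def of_nat_scal)
    finally show ?thesis by (simp only: lead_at_scal_mult symbol_def coeff_symbol_at)
  qed
  then have "degree (symbol c) = 0" if "t = degree (symbol b)"
    using that by (intro le_antisym degree_le) (auto simp: coeff_eq_0)
  moreover obtain i k j where "val c = val (monomial i k j)"
    using val_in[OF c] by (auto simp: val_monomial)
  ultimately show ?thesis using that[of i k j] degree_symbol[OF c] v by simp
qed

text \<open>
  If \<open>q = 0\<close>, all three degrees vanish by the degree relation, but \<open>slope_attained\<close> provides a
  nonconstant symbol.
\<close>

lemma q_pos: "q > 0"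
proof (rule ccontr)
  assume "\<not> q > 0"
  then have "p = 0" "l = 0" "q = 0" using degree_relation r_ge by auto
  then have const: "degree (symbol g) = 0" if "g \<in> {x, y, z}" for g
    using that by (auto simp: p_def q_def l_def)
  obtain g i where g: "g \<in> {x, y, z}" "i \<ge> 1" "poly.coeff (\<Phi> g) i \<noteq> 0"
    "val (poly.coeff (\<Phi> g) i) = val g - of_nat i * \<mu>"
    using slope_attained by blast
  then have "poly.coeff (symbol g) i \<noteq> 0" by (simp add: symbol_def coeff_symbol_at lead_at_def)
  then have "i \<le> degree (symbol g)" by (rule le_degree)
  then show False using const g by simp
qed

lemma leading_coefficient_val:
  assumes "b \<in> B" "b \<noteq> 0"
  obtains i k j where "val b - of_nat (degree (symbol b)) * \<mu> = val (monomial i k j)"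
    "i * p + k * l + j * q = 0"
  using coefficient_of_symbol[OF assms, of "degree (symbol b)"] symbol_nz[OF assms]
  by (metis leading_coeff_0_iff)

lemma udeg_mu: "udeg \<mu> = 1"
proof -
  obtain i k j where "val z - of_nat q * \<mu> = val (monomial i k j)" "i * p + k * l + j * q = 0"
    using leading_coefficient_val[OF z_in z_nz] by (auto simp: q_def)
  then have "udeg (val z - of_nat q * \<mu>) = 0" by (simp only: udeg_monomial of_nat_0)
  then have "of_nat q - of_nat q * udeg \<mu> = 0"
    using udeg_val[OF z_in z_nz] by (simp add: udeg_diff q_def)
  then show ?thesis using q_pos by simp
qed

text \<open>
  Geometrically, with \<open>y\<close> as a scalar and up to powers of \<open>y\<close>, the curve \<open>x^r y = z^d\<close> is the cusp
  \<open>x = T^d\<close>, \<open>z = T^r\<close> with coprime \<open>r, d \<ge> 2\<close>. The exponential map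
  sends \<open>T\<close> to a polynomial \<open>H\<close> in \<open>U\<close> of positive degree. Near its top, the expansion of \<open>H^d\<close> or of
  \<open>H^r\<close> then has a coefficient of symbol degree between 1 and that of \<open>T\<close>, but nonconstant monomials
  on the cusp have at least twice the degree of \<open>T\<close>.
\<close>

lemma p_eq_0: "p = 0"
proof (rule ccontr)
  assume "p \<noteq> 0"
  obtain i k j where "val x - of_nat p * \<mu> = val (monomial i k j)" "i * p + k * l + j * q = 0"
    using leading_coefficient_val[OF x_in x_nz] by (auto simp: p_def)
  then have kx: "val x - of_nat p * \<mu> = val (monomial 0 k 0)" and kl: "k * l = 0"
    using \<open>p \<noteq> 0\<close> q_pos by auto
  obtain i k' j where "val z - of_nat q * \<mu> = val (monomial i k' j)" "i * p + k' * l + j * q = 0"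
    using leading_coefficient_val[OF z_in z_nz] by (auto simp: q_def)
  then have kz: "val z - of_nat q * \<mu> = val (monomial 0 k' 0)" and kl': "k' * l = 0"
    using \<open>p \<noteq> 0\<close> q_pos by auto
  \<comment> \<open>The values are compared coordinate by coordinate: index 0 is the degree in \<open>x\<close>, index 1 in \<open>z\<close>.\<close>
  define m0 m1 where "m0 = poly.coeff \<mu> 0" and "m1 = poly.coeff \<mu> 1"
  have x0: "1 - of_nat p * m0 = - (of_nat r * of_nat k)" and x1: "- of_nat p * m1 = of_nat d * of_nat k"
    using arg_cong[OF kx, of "\<lambda>w. poly.coeff w 0"] arg_cong[OF kx, of "\<lambda>w. poly.coeff w 1"]
    by (simp_all add: val_x val_monomial weight_def of_nat_poly m0_def m1_def)
  have z1: "1 - of_nat q * m1 = of_nat d * of_nat k'"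
    using arg_cong[OF kz, of "\<lambda>w. poly.coeff w 1"]
    by (simp_all add: val_z val_monomial weight_def of_nat_poly m1_def)
  have k'p: "of_nat p * (of_nat d * of_nat k') = (of_nat p + of_nat q * of_nat d * of_nat k :: rat)"
  proof -
    have "of_nat p * (of_nat d * of_nat k') = of_nat p + of_nat q * (- of_nat p * m1)"
      unfolding z1[symmetric] by (simp add: algebra_simps)
    then show ?thesis unfolding x1 by simp
  qed
  have "k' \<noteq> 0"
  proof
    assume "k' = 0"
    then have "of_nat p + of_nat q * of_nat d * of_nat k = (0 :: rat)" using k'p by simp
    then have "of_nat (p + q * d * k) = (0 :: rat)" by simp
    then have "p + q * d * k = 0" by (simp only: of_nat_eq_0_iff)
    then show False using \<open>p \<noteq> 0\<close> by simp
  qed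
  then have "l = 0" using kl' by simp
  then have rp: "r * p = d * q" using degree_relation by simp
  have "of_nat (p * (d * k')) = (of_nat (p + q * d * k) :: rat)" using k'p by simp
  then have "p * (d * k') = p + q * d * k" by (simp only: of_nat_eq_iff)
  also have "\<dots> = p * (1 + r * k)" using rp by (simp add: algebra_simps)
  finally have bezout: "d * k' = 1 + r * k" using \<open>p \<noteq> 0\<close> by (simp only: mult_cancel1) simp
  have "degree (symbol y) = 0" using \<open>l = 0\<close> by (simp add: l_def)
  moreover have "poly.coeff (symbol y) 0 = 1" using coeff_0_symbol[OF y_in] lead_scalar_y by simp
  ultimately have "symbol y = 1" by (auto elim!: degree_eq_zeroE simp: one_pCons)
  then have "symbol x ^ r = symbol z ^ d" using symbol_relation by simp
  then obtain H where H: "symbol x = H ^ d" "symbol z = H ^ r"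
    using common_root_of_equal_powers[OF _ bezout] d_ge symbol_nz[OF z_in z_nz] by auto
  define h where "h = degree H"
  have H_nz: "H \<noteq> 0" using H(2) symbol_nz[OF z_in z_nz] r_ge by auto
  have ph: "p = d * h" and qh: "q = r * h"
    using H H_nz by (simp_all add: p_def q_def h_def degree_power_eq)
  have h_pos: "h > 0" using ph \<open>p \<noteq> 0\<close> by (cases h) auto
  have "poly.coeff (H ^ d) 0 \<noteq> 0"
    using coeff_0_symbol[OF x_in] lead_scalar_x H(1) by simp
  then have H0: "poly.coeff H 0 \<noteq> 0" using d_ge by (auto simp: coeff_0_power)
  \<comment> \<open>A symbol that is an \<open>n\<close>-th power of \<open>H\<close> with \<open>n\<close> invertible in \<open>K\<close> has a coefficient too near the top.\<close>
  have contra: False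
    if b: "b \<in> B" "b \<noteq> 0" "symbol b = H ^ n" and n: "of_nat n \<noteq> (0 :: 'k)" for b n
  proof -
    obtain s where s: "0 < s" "s \<le> h" "poly.coeff (symbol b) (n * h - s) \<noteq> 0"
      using power_coeff_near_top[OF H0 _ n] h_pos b(3) by (auto simp: h_def)
    have deg: "degree (symbol b) = n * h" using b(3) H_nz by (simp add: degree_power_eq h_def)
    have "n \<noteq> 0" using n by (metis of_nat_0)
    then have "s \<le> n * h" using s(2) by (cases n) auto
    obtain i k j where "val b - of_nat (n * h - s) * \<mu> = val (monomial i k j)"
      using coefficient_of_symbol[OF b(1,2) s(3)] by blast
    then have "of_nat (i * p + k * l + j * q) = udeg (val b - of_nat (n * h - s) * \<mu>)"
      by (simp only: udeg_monomial)
    also have "\<dots> = of_nat (n * h) - of_nat (n * h - s)"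
      unfolding udeg_diff udeg_mu udeg_val[OF b(1,2)] deg by simp
    also have "\<dots> = of_nat s" using \<open>s \<le> n * h\<close> by (simp add: of_nat_diff)
    finally have "of_nat (i * p + k * l + j * q) = (of_nat s :: rat)" .
    then have "i * p + k * l + j * q = s" by (simp only: of_nat_eq_iff)
    then have "s = i * p + j * q" using \<open>l = 0\<close> by simp
    also have "\<dots> = (i * d + j * r) * h" by (simp add: ph qh algebra_simps)
    finally have s_eq: "s = (i * d + j * r) * h" .
    \<comment> \<open>Symbol degrees are spanned by \<open>d h\<close> and \<open>r h\<close>, hence are 0 or at least \<open>2 h\<close>.\<close>
    then have "i * d + j * r \<noteq> 0" using s(1) by auto
    then have "i * d + j * r \<ge> 2" using r_ge d_ge by (cases i; cases j) auto
    then have "s \<ge> 2 * h" unfolding s_eq by (rule mult_right_mono) simp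
    then show False using s h_pos by simp
  qed
  \<comment> \<open>The Bezout relation survives in \<open>K\<close>, so \<open>d\<close> and \<open>r\<close> cannot both vanish there.\<close>
  have "of_nat d * of_nat k' = (1 + of_nat r * of_nat k :: 'k)"
    using arg_cong[OF bezout, of "of_nat :: nat \<Rightarrow> 'k"] by simp
  then have "of_nat d \<noteq> (0 :: 'k) \<or> of_nat r \<noteq> (0 :: 'k)" by auto
  then show False
    using contra[OF x_in x_nz H(1)] contra[OF z_in z_nz H(2)] by blast
qed

text \<open>
  A weight is an arbitrary rational polynomial; the relation \<open>v(z) - q \<mu> = v(x^i y^k z^j)\<close> confines
  \<open>\<mu>\<close> to degree at most 1, where the order is the lexicographic one.
\<close>

lemma mu_eq: "\<mu> = [:poly.coeff \<mu> 0, poly.coeff \<mu> 1:]"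
proof -
  obtain i k j where ikj: "val z - of_nat q * \<mu> = val (monomial i k j)"
    unfolding q_def using leading_coefficient_val[OF z_in z_nz] by blast
  have "poly.coeff \<mu> (Suc (Suc n)) = 0" for n
    using arg_cong[OF ikj, of "\<lambda>w. poly.coeff w (Suc (Suc n))"] q_pos
    by (simp add: val_def weight_def of_nat_poly)
  then show ?thesis by (auto simp: poly_eq_iff coeff_pCons numeral_eq_Suc split: nat.split)
qed

lemma mu_z_degree_pos: "poly.coeff \<mu> 1 > 0"
proof -
  have "poly.coeff \<mu> 1 * of_nat q = 1" using udeg_mu by (simp add: udeg_def p_eq_0)
  then show ?thesis using q_pos by (metis of_nat_0_less_iff zero_less_mult_pos2 zero_less_one)
qed

lemma Phi_x: "\<Phi> x = [:x:]"
proof (rule poly_eqI)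
  fix i
  show "poly.coeff (\<Phi> x) i = poly.coeff [:x:] i"
  proof (cases i)
    case 0
    then show ?thesis by (simp add: coeff_Phi_0 x_in)
  next
    case (Suc i')
    have "poly.coeff (\<Phi> x) i = 0"
    proof (rule ccontr)
      let ?c = "poly.coeff (\<Phi> x) i"
      assume "?c \<noteq> 0"
      then have "val ?c \<le> val x - of_nat i * \<mu>"
        using slope[of x i] by (simp add: below_def)
      also have "\<dots> = [:1 - of_nat i * poly.coeff \<mu> 0, - of_nat i * poly.coeff \<mu> 1:]"
        by (subst mu_eq) (simp add: val_x weight_def of_nat_poly)
      finally have "of_nat (degree ?c) \<le> - of_nat i * poly.coeff \<mu> 1"
        unfolding val_def weight_def by (auto dest: le_poly_imp_coeff_1_le)
      then have "of_nat i * poly.coeff \<mu> 1 \<le> 0"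
        by (metis add.inverse_inverse mult_minus_left neg_le_0_iff_le of_nat_0_le_iff order_trans)
      then show False
        using mu_z_degree_pos Suc by (simp add: mult_le_0_iff)
    qed
    then show ?thesis by (simp add: Suc)
  qed
qed

lemma invariant_z_degree:
  assumes "b \<in> B" "\<Phi> b = [:b:]"
  shows "degree b = 0"
proof (cases "b = 0")
  case False
  have "degree (symbol b) = 0"
    by (intro le_antisym degree_le)
       (auto simp: symbol_def coeff_symbol_at assms(2) coeff_pCons split: nat.split)
  then have "udeg (val b) = 0" using udeg_val[OF assms(1) False] by simp
  then show ?thesis using q_pos by (simp add: udeg_def p_eq_0 val_def weight_def)
qed simp

end

context exponential_subring
begin

lemma invariant_if_generators_invariant:
  assumes "\<And>g. g \<in> {x, y, z} \<Longrightarrow> \<Phi> g = [:g:]" and "b \<in> B"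
  shows "\<Phi> b = [:b:]"
  using \<open>b \<in> B\<close>
proof (induction rule: subring_induct)
  case (add c i k j b)
  have pow: "\<Phi> (g ^ n) = [:g ^ n:]" if "g \<in> {x, y, z}" for g n
  proof -
    have "g \<in> B" using that x_in y_in z_in by auto
    then show ?thesis
      by (induction n) (simp_all add: Phi_1 Phi_mult power_in assms(1)[OF that] mult.commute flip: one_pCons)
  qed
  have "\<Phi> (monomial i k j) = [:monomial i k j:]"
    by (simp add: monomial_def Phi_mult mult_in power_in x_in y_in z_in pow mult.commute)
  then show ?case
    using add by (simp add: Phi_add Phi_mult mult_in scal_in monomial_in Phi_scal)
qed (simp add: Phi_0)

text \<open>
  Only finitely many slopes occur, and at least one does, because a map that fixes the generators
  fixes all of \<open>B\<close>.
\<close>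

lemma exponential_slope_exists:
  assumes "b \<in> B" "\<Phi> b \<noteq> [:b:]"
  obtains \<mu> where "exponential_slope B y r d \<Phi> \<mu>"
proof -
  define I where "I = {(g, i). g \<in> {x, y, z} \<and> i \<ge> 1 \<and> poly.coeff (\<Phi> g) i \<noteq> 0}"
  define s where "s = (\<lambda>(g, i). smult (1 / of_nat i) (val g - val (poly.coeff (\<Phi> g) i)))"
  define \<mu> where "\<mu> = Min (s ` I)"
  have s: "of_nat i * s (g, i) = val g - val (poly.coeff (\<Phi> g) i)" if "i \<ge> 1" for g i
    using that by (simp add: s_def of_nat_poly)
  have "I \<subseteq> (\<Union>g\<in>{x, y, z}. Pair g ` {..degree (\<Phi> g)})"
    by (auto simp: I_def intro: le_degree)
  then have fin: "finite (s ` I)"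
    by (intro finite_imageI) (erule finite_subset, simp)
  have "s ` I \<noteq> {}"
  proof
    assume "s ` I = {}"
    then have none: "poly.coeff (\<Phi> g) i = 0" if "g \<in> {x, y, z}" "i \<ge> 1" for g i
      using that by (auto simp: I_def)
    have "\<Phi> g = [:g:]" if g: "g \<in> {x, y, z}" for g
    proof (rule poly_eqI)
      fix i
      have "g \<in> B" using g x_in y_in z_in by auto
      then show "poly.coeff (\<Phi> g) i = poly.coeff [:g:] i"
        using none[OF g, of i] by (cases i) (simp_all add: coeff_Phi_0)
    qed
    then show False using invariant_if_generators_invariant assms by blast
  qed
  then have "\<mu> \<in> s ` I" unfolding \<mu>_def using fin by (rule_tac Min_in)
  then obtain g0 i0 where gi0: "g0 \<in> {x, y, z}" "i0 \<ge> 1" "poly.coeff (\<Phi> g0) i0 \<noteq> 0"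
    and mu0: "\<mu> = s (g0, i0)"
    by (auto simp: I_def)
  have "exponential_slope B y r d \<Phi> \<mu>"
  proof unfold_locales
    fix g i assume g: "g \<in> {x, y, z}"
    show "below (val g - of_nat i * \<mu>) (poly.coeff (\<Phi> g) i)"
    proof (cases "i = 0 \<or> poly.coeff (\<Phi> g) i = 0")
      case True
      moreover have "g \<in> B" using g x_in y_in z_in by auto
      ultimately show ?thesis by (auto simp: below_def coeff_Phi_0)
    next
      case False
      then have "(g, i) \<in> I" using g by (simp add: I_def)
      then have "\<mu> \<le> s (g, i)" unfolding \<mu>_def using fin by (intro Min_le) auto
      then have "of_nat i * \<mu> \<le> of_nat i * s (g, i)" by (rule mult_left_mono) simp
      also have "\<dots> = val g - val (poly.coeff (\<Phi> g) i)" using False by (intro s) simp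
      finally show ?thesis by (simp add: below_def algebra_simps)
    qed
  next
    show "\<exists>g\<in>{x, y, z}. \<exists>i\<ge>1. poly.coeff (\<Phi> g) i \<noteq> 0 \<and>
        val (poly.coeff (\<Phi> g) i) = val g - of_nat i * \<mu>"
      using gi0 s[OF gi0(2), of g0] unfolding mu0
      by (intro bexI[of _ g0] exI[of _ i0]) (auto simp: algebra_simps)
  qed
  then show ?thesis by (rule that)
qed

theorem x_invariant:
  assumes "b \<in> B" "\<Phi> b \<noteq> [:b:]"
  shows "\<Phi> x = [:x:]"
proof -
  obtain \<mu> where "exponential_slope B y r d \<Phi> \<mu>"
    using exponential_slope_exists assms by blast
  then show ?thesis by (rule exponential_slope.Phi_x)
qed

theorem invariants_have_z_degree_0:
  assumes "b \<in> B" "\<Phi> b \<noteq> [:b:]" and "c \<in> B" "\<Phi> c = [:c:]"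
  shows "degree c = 0"
proof -
  obtain \<mu> where "exponential_slope B y r d \<Phi> \<mu>"
    using exponential_slope_exists assms by blast
  then show ?thesis using assms(3,4) by (rule exponential_slope.invariant_z_degree)
qed

lemma poly_in_x_if_z_degree_0:
  assumes "b \<in> B" "degree b = 0"
  shows "\<exists>a. b = [:embX a:]"
  using assms
proof (induction rule: subring_induct)
  case zero
  then show ?case by (intro exI[of _ 0]) (simp add: embX_simps)
next
  case (add c i k j b)
  have nz: "scal c * monomial i k j \<noteq> 0" using add by simp
  have v: "val (scal c * monomial i k j) = val (monomial i k j)"
    using add by (simp add: val_mult val_scal)
  then have "val (scal c * monomial i k j + b) = val (monomial i k j)"
    using val_add_less(1)[OF nz, of b] add by (simp add: add.commute)
  then have "int (degree (scal c * monomial i k j + b)) = int d * int k + int j"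
    unfolding val_monomial unfolding val_def weight_eq_iff by blast
  then have "int d * int k + int j = 0" using add.prems by simp
  then have kj: "k = 0" "j = 0" using d_ge by (auto simp: add_nonneg_eq_0_iff)
  have "degree b = 0"
    using add(3) by (auto simp: val_monomial kj) (auto simp: val_def weight_less_iff)
  then obtain a where a: "b = [:embX a:]" using add.IH by blast
  have "embX (monom c i) = fls_const c * fls_X_inv ^ i"
    by (induction i) (simp_all add: monom_0 monom_Suc embX_pCons embX_simps)
  then have "scal c * monomial i k j = [:embX (monom c i):]"
    by (simp add: kj monomial_def scal_def x_elt_def poly_const_pow)
  then show ?case
    by (intro exI[of _ "monom c i + a"]) (simp add: a embX_simps)
qed

end

section \<open>Polynomial rings over a carrier and polynomials over a type\<close>

lemma UP_in_carrier: "p \<in> carrier (UP S) \<Longrightarrow> p i \<in> carrier S"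
  by (auto simp: UP_def)

lemma coeff_UP: "p \<in> carrier (UP S) \<Longrightarrow> up_ring.coeff (UP S) p = p"
  by (simp add: UP_def)

lemma add_UP: "p \<in> carrier (UP S) \<Longrightarrow> q \<in> carrier (UP S) \<Longrightarrow>
    p \<oplus>\<^bsub>UP S\<^esub> q = (\<lambda>i. p i \<oplus>\<^bsub>S\<^esub> q i)"
  by (simp add: UP_def)

lemma mult_UP: "p \<in> carrier (UP S) \<Longrightarrow> q \<in> carrier (UP S) \<Longrightarrow>
    p \<otimes>\<^bsub>UP S\<^esub> q = (\<lambda>n. \<Oplus>\<^bsub>S\<^esub>i\<in>{..n}. p i \<otimes>\<^bsub>S\<^esub> q (n - i))"
  by (simp add: UP_def)

lemma one_UP: "\<one>\<^bsub>UP S\<^esub> = (\<lambda>i. if i = 0 then \<one>\<^bsub>S\<^esub> else \<zero>\<^bsub>S\<^esub>)"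
  by (simp add: UP_def)

lemma monom_UP:
  "a \<in> carrier S \<Longrightarrow> up_ring.monom (UP S) a n = (\<lambda>i. if i = n then a else \<zero>\<^bsub>S\<^esub>)"
  by (simp add: UP_def)

text \<open>
  Homomorphisms from a ring with a carrier set to a ring given by a type. They extend coefficientwise
  to polynomial rings, and doing this twice moves identities in \<open>A[U,V]\<close> to nested polynomial types,
  where coefficients can be compared.
\<close>

locale ring_to_type = cring S for S (structure) +
  fixes h :: "'a \<Rightarrow> 'r::comm_ring_1"
  assumes h_add: "a \<in> carrier S \<Longrightarrow> b \<in> carrier S \<Longrightarrow> h (a \<oplus> b) = h a + h b"
    and h_mult: "a \<in> carrier S \<Longrightarrow> b \<in> carrier S \<Longrightarrow> h (a \<otimes> b) = h a * h b"
    and h_one: "h \<one> = 1"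
begin

lemma h_zero: "h \<zero> = 0"
  using h_add[of \<zero> \<zero>] by simp

lemma h_finsum:
  assumes "finite I" "\<And>i. i \<in> I \<Longrightarrow> F i \<in> carrier S"
  shows "h (finsum S F I) = (\<Sum>i\<in>I. h (F i))"
  using assms
proof (induction I)
  case (insert i I)
  then have "finsum S F (insert i I) = F i \<oplus> finsum S F I"
    by (intro finsum_insert) auto
  then show ?case using insert by (simp add: h_add Pi_def)
qed (simp add: h_zero)

lemma h_pow: "a \<in> carrier S \<Longrightarrow> h (a [^] (n::nat)) = h a ^ n"
  by (induction n) (simp_all add: h_one h_mult power_Suc2 del: power_Suc)

definition up_map :: "(nat \<Rightarrow> 'a) \<Rightarrow> 'r poly" where
  "up_map p = (\<Sum>i\<le>deg S p. Polynomial.monom (h (p i)) i)"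

lemma UP_cring_S: "UP_cring S"
  by unfold_locales

lemma coeff_up_map:
  assumes "p \<in> carrier (UP S)"
  shows "poly.coeff (up_map p) i = h (p i)"
proof -
  have "p i = \<zero>" if "i > deg S p"
    using UP_ring.deg_aboveD[of S p i] that assms ring_axioms by (simp add: UP_ring_def coeff_UP)
  then show ?thesis
    by (auto simp: up_map_def coeff_sum if_distrib h_zero cong: if_cong)
qed

lemma up_map_ring_to_type: "ring_to_type (UP S) up_map"
proof (intro ring_to_type.intro ring_to_type_axioms.intro)
  show cring: "cring (UP S)" by (rule UP_cring.UP_cring[OF UP_cring_S])
  {
    fix p q assume pq: "p \<in> carrier (UP S)" "q \<in> carrier (UP S)"
    then have in_UP: "p \<oplus>\<^bsub>UP S\<^esub> q \<in> carrier (UP S)" "p \<otimes>\<^bsub>UP S\<^esub> q \<in> carrier (UP S)"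
      using cring by (simp_all add: cring_def ring.ring_simprules)
    show "up_map (p \<oplus>\<^bsub>UP S\<^esub> q) = up_map p + up_map q"
    proof (rule poly_eqI)
      fix n
      have "poly.coeff (up_map (p \<oplus>\<^bsub>UP S\<^esub> q)) n = h (p n \<oplus> q n)"
        by (subst coeff_up_map[OF in_UP(1)]) (simp only: add_UP[OF pq])
      then show "poly.coeff (up_map (p \<oplus>\<^bsub>UP S\<^esub> q)) n = poly.coeff (up_map p + up_map q) n"
        using pq by (simp add: h_add UP_in_carrier coeff_up_map)
    qed
    show "up_map (p \<otimes>\<^bsub>UP S\<^esub> q) = up_map p * up_map q"
    proof (rule poly_eqI)
      fix n
      have "poly.coeff (up_map (p \<otimes>\<^bsub>UP S\<^esub> q)) n = h (\<Oplus>i\<in>{..n}. p i \<otimes> q (n - i))"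
        by (subst coeff_up_map[OF in_UP(2)]) (simp only: mult_UP[OF pq])
      also have "\<dots> = (\<Sum>i\<le>n. h (p i \<otimes> q (n - i)))"
        using pq by (intro h_finsum) (auto intro: UP_in_carrier)
      finally show "poly.coeff (up_map (p \<otimes>\<^bsub>UP S\<^esub> q)) n = poly.coeff (up_map p * up_map q) n"
        using pq by (simp add: h_mult UP_in_carrier coeff_up_map coeff_mult)
    qed
  }
  have "\<one>\<^bsub>UP S\<^esub> \<in> carrier (UP S)"
    using cring by (simp add: cring_def ring.ring_simprules)
  then have "poly.coeff (up_map \<one>\<^bsub>UP S\<^esub>) n = (if n = 0 then 1 else 0)" for n
    by (subst coeff_up_map) (simp_all add: one_UP h_one h_zero)
  then show "up_map \<one>\<^bsub>UP S\<^esub> = 1"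
    by (intro poly_eqI) simp
qed

lemma const_poly_in: "a \<in> carrier S \<Longrightarrow> const_poly S a \<in> carrier (UP S)"
  and indet_in: "indet S \<in> carrier (UP S)"
  unfolding const_poly_def indet_def
  by (intro UP_ring.monom_closed UP_ring.intro ring_axioms one_closed; assumption)+

lemma up_map_const_poly:
  assumes "a \<in> carrier S"
  shows "up_map (const_poly S a) = [:h a:]"
proof (rule poly_eqI)
  fix i
  have "poly.coeff (up_map (const_poly S a)) i = h (if i = 0 then a else \<zero>)"
    by (subst coeff_up_map[OF const_poly_in[OF assms]])
       (simp only: const_poly_def monom_UP[OF assms])
  then show "poly.coeff (up_map (const_poly S a)) i = poly.coeff [:h a:] i"
    by (cases i) (simp_all add: h_zero)
qed

lemma up_map_indet: "up_map (indet S) = [:0, 1:]"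
proof (rule poly_eqI)
  fix i
  have "poly.coeff (up_map (indet S)) i = h (if i = 1 then \<one> else \<zero>)"
    by (subst coeff_up_map[OF indet_in]) (simp only: indet_def monom_UP[OF one_closed])
  then show "poly.coeff (up_map (indet S)) i = poly.coeff [:0, 1:] i"
    by (cases i) (auto simp: h_zero h_one coeff_pCons split: nat.split)
qed

end

lemma (in ring_to_type) h_eval:
  assumes p: "p \<in> carrier (UP R)" and \<kappa>: "\<And>a. a \<in> carrier R \<Longrightarrow> \<kappa> a \<in> carrier S" and t: "t \<in> carrier S"
  shows "h (UnivPoly.eval R S \<kappa> t p) = (\<Sum>i\<le>deg R p. h (\<kappa> (p i)) * h t ^ i)"
    and "UnivPoly.eval R S \<kappa> t p \<in> carrier S"
proof -
  have e: "UnivPoly.eval R S \<kappa> t p = (\<Oplus>i\<in>{..deg R p}. \<kappa> (p i) \<otimes> t [^] i)"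
  proof -
    have "up_ring.coeff (UP R) p = p"
      using p by (simp add: UP_def)
    then show ?thesis using p unfolding UnivPoly.eval_def by simp
  qed
  show "h (UnivPoly.eval R S \<kappa> t p) = (\<Sum>i\<le>deg R p. h (\<kappa> (p i)) * h t ^ i)"
    using p \<kappa> t unfolding e by (simp add: h_finsum h_mult h_pow UP_in_carrier)
  show "UnivPoly.eval R S \<kappa> t p \<in> carrier S"
    using p \<kappa> t unfolding e by (auto intro!: finsum_closed simp: UP_in_carrier)
qed

section \<open>Exponential maps as families of operators\<close>

lemma coeff_coeff_VU:
  "poly.coeff (poly.coeff ([:[:c:]:] * [:0, 1:] ^ m * [:[:0, 1:]:] ^ n) j) i =
    (if m = j \<and> n = i then c else 0)" for c :: "'r::comm_ring_1"
proof -
  have V: "[:0, 1:] ^ m = Polynomial.monom (1 :: 'r poly) m"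
    by (simp add: monom_altdef)
  have U: "[:[:0, 1:]:] ^ n = [:Polynomial.monom (1 :: 'r) n:]"
    by (simp add: poly_const_pow monom_altdef)
  have "[:[:c:]:] * [:0, 1:] ^ m * [:[:0, 1:]:] ^ n = Polynomial.monom (Polynomial.monom c n) m"
    unfolding V U by (simp add: smult_monom mult.commute[of _ "[:_:]"])
  then show ?thesis by simp
qed

locale exponential_transfer = ring_to_type A h for A (structure) and h :: "'a \<Rightarrow> 'r::comm_ring_1" +
  fixes \<phi> :: "'a \<Rightarrow> nat \<Rightarrow> 'a"
  assumes h_inj: "inj_on h (carrier A)"
    and phi_hom: "\<phi> \<in> ring_hom A (UP A)"
    and phi_eval: "a \<in> carrier A \<Longrightarrow> UnivPoly.eval A A (\<lambda>b. b) \<zero> (\<phi> a) = a"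
    and phi_phi: "a \<in> carrier A \<Longrightarrow>
      exp_V_ext A \<phi> (\<phi> a) = exp_at A \<phi> (indet_V A \<oplus>\<^bsub>UP (UP A)\<^esub> indet_U A) a"
begin

definition Phi :: "'r \<Rightarrow> 'r poly" where
  "Phi b = up_map (\<phi> (inv_into (carrier A) h b))"

lemma phi_in: "a \<in> carrier A \<Longrightarrow> \<phi> a \<in> carrier (UP A)"
  using phi_hom by (rule ring_hom_closed)

lemma phi_coeff_in: "a \<in> carrier A \<Longrightarrow> \<phi> a i \<in> carrier A"
  using phi_in by (rule UP_in_carrier)

lemma Phi_h: "a \<in> carrier A \<Longrightarrow> Phi (h a) = up_map (\<phi> a)"
  using h_inj by (simp add: Phi_def)

lemma coeff_Phi_h: "a \<in> carrier A \<Longrightarrow> poly.coeff (Phi (h a)) i = h (\<phi> a i)"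
  by (simp add: Phi_h coeff_up_map phi_in)

lemma Phi_h_add: "a \<in> carrier A \<Longrightarrow> b \<in> carrier A \<Longrightarrow> Phi (h a + h b) = Phi (h a) + Phi (h b)"
proof -
  interpret up: ring_to_type "UP A" up_map by (rule up_map_ring_to_type)
  show "a \<in> carrier A \<Longrightarrow> b \<in> carrier A \<Longrightarrow> Phi (h a + h b) = Phi (h a) + Phi (h b)"
    by (simp add: Phi_h phi_in up.h_add ring_hom_add[OF phi_hom] flip: h_add)
qed

lemma Phi_h_mult: "a \<in> carrier A \<Longrightarrow> b \<in> carrier A \<Longrightarrow> Phi (h a * h b) = Phi (h a) * Phi (h b)"
proof -
  interpret up: ring_to_type "UP A" up_map by (rule up_map_ring_to_type)
  show "a \<in> carrier A \<Longrightarrow> b \<in> carrier A \<Longrightarrow> Phi (h a * h b) = Phi (h a) * Phi (h b)"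
    by (simp add: Phi_h phi_in up.h_mult ring_hom_mult[OF phi_hom] flip: h_mult)
qed

lemma Phi_h_const: "a \<in> carrier A \<Longrightarrow> Phi (h a) = [:h a:] \<longleftrightarrow> \<phi> a = const_poly A a"
proof
  assume a: "a \<in> carrier A" and eq: "Phi (h a) = [:h a:]"
  show "\<phi> a = const_poly A a"
  proof
    fix i
    have "h (\<phi> a i) = h (const_poly A a i)"
      using a eq by (metis coeff_Phi_h coeff_up_map const_poly_in up_map_const_poly)
    then show "\<phi> a i = const_poly A a i"
      using h_inj a by (auto dest: inj_onD intro: phi_coeff_in UP_in_carrier const_poly_in)
  qed
qed (simp add: Phi_h up_map_const_poly)

lemma coeff_Phi_h_0:
  assumes "a \<in> carrier A"
  shows "poly.coeff (Phi (h a)) 0 = h a"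
proof -
  have "h (UnivPoly.eval A A (\<lambda>b. b) \<zero> (\<phi> a)) = (\<Sum>i\<le>deg A (\<phi> a). h (\<phi> a i) * 0 ^ i)"
    using h_eval(1)[OF phi_in[OF assms], of "\<lambda>b. b" \<zero>] by (simp add: h_zero)
  also have "\<dots> = h (\<phi> a 0)" by (simp add: power_0_left if_distrib cong: if_cong)
  finally show ?thesis unfolding coeff_Phi_h[OF assms] phi_eval[OF assms] by (rule sym)
qed

text \<open>
  Comparing the coefficients of \<open>V^j U^i\<close> in the composition law: one side is the iterated operator,
  the other the coefficient of the binomial expansion of \<open>(V + U)^(i+j)\<close>.
\<close>

lemma Phi_Phi_h:
  assumes a: "a \<in> carrier A"
  shows "poly.coeff (Phi (poly.coeff (Phi (h a)) i)) j =
    of_nat ((i + j) choose i) * poly.coeff (Phi (h a)) (i + j)"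
proof -
  interpret up: ring_to_type "UP A" up_map by (rule up_map_ring_to_type)
  interpret up2: ring_to_type "UP (UP A)" up.up_map by (rule up.up_map_ring_to_type)
  let ?H = up.up_map and ?V = "[:0, 1:] :: 'r poly poly" and ?U = "[:[:0, 1:]:] :: 'r poly poly"
  have bi: "biconst A b \<in> carrier (UP (UP A))" "?H (biconst A b) = [:[:h b:]:]" if "b \<in> carrier A" for b
    using that
    by (simp_all add: biconst_def up.const_poly_in const_poly_in up.up_map_const_poly up_map_const_poly)
  have V: "indet_V A \<in> carrier (UP (UP A))" "?H (indet_V A) = ?V"
    by (simp_all add: indet_V_def up.indet_in up.up_map_indet)
  have U: "indet_U A \<in> carrier (UP (UP A))" "?H (indet_U A) = ?U"
    by (simp_all add: indet_U_def indet_in up.const_poly_in up.up_map_const_poly up_map_indet)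
  have at: "exp_at A \<phi> t b \<in> carrier (UP (UP A))"
    "?H (exp_at A \<phi> t b) = (\<Sum>n\<le>deg A (\<phi> b). [:[:h (\<phi> b n):]:] * ?H t ^ n)"
    if "b \<in> carrier A" "t \<in> carrier (UP (UP A))" for b t
    using that up2.h_eval[OF phi_in, of b "biconst A" t]
    by (simp_all add: exp_at_def bi phi_coeff_in)
  have h_above: "h (\<phi> b n) = 0" if "b \<in> carrier A" "n > deg A (\<phi> b)" for b n
    using coeff_up_map[OF phi_in[OF that(1)], of n] that
    by (simp add: up_map_def coeff_sum)
  have lhs: "poly.coeff (poly.coeff (?H (exp_V_ext A \<phi> (\<phi> a))) j) i = h (\<phi> (\<phi> a i) j)"
  proof -
    have "?H (exp_V_ext A \<phi> (\<phi> a)) = (\<Sum>m\<le>deg A (\<phi> a). \<Sum>n\<le>deg A (\<phi> (\<phi> a m)).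
        [:[:h (\<phi> (\<phi> a m) n):]:] * ?V ^ n * ?U ^ m)"
      using up2.h_eval(1)[OF phi_in[OF a], of "exp_at A \<phi> (indet_V A)" "indet_U A"] a
      by (simp add: exp_V_ext_def at V U phi_coeff_in sum_distrib_right del: mult_pCons_left mult_pCons_right)
    then have "poly.coeff (poly.coeff (?H (exp_V_ext A \<phi> (\<phi> a))) j) i =
        (\<Sum>m\<le>deg A (\<phi> a). \<Sum>n\<le>deg A (\<phi> (\<phi> a m)). if n = j \<and> m = i then h (\<phi> (\<phi> a m) n) else 0)"
      by (simp only: coeff_sum coeff_coeff_VU)
    \<comment> \<open>If \<open>j\<close> exceeds the inner degree bound, the coefficient vanishes, as does the empty inner sum.\<close>
    also have "\<dots> = (\<Sum>m\<le>deg A (\<phi> a). if m = i then h (\<phi> (\<phi> a m) j) else 0)"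
      using h_above[OF phi_coeff_in[OF a]] by (intro sum.cong refl) (auto simp: not_le)
    also have "\<dots> = h (\<phi> (\<phi> a i) j)"
    proof (cases "i \<le> deg A (\<phi> a)")
      case False
      then have "h (\<phi> a i) = 0" using h_above[OF a, of i] by simp
      then have "\<phi> a i = \<zero>" using h_inj h_zero phi_coeff_in[OF a] by (metis inj_onD zero_closed)
      moreover have "h (\<phi> \<zero> j) = 0"
      proof -
        have "Phi (h \<zero> + h \<zero>) = Phi (h \<zero>) + Phi (h \<zero>)" by (rule Phi_h_add) simp_all
        then have "Phi (h \<zero>) = 0" by (simp add: h_zero)
        then show ?thesis using coeff_Phi_h[of \<zero> j] by simp
      qed
      ultimately show ?thesis using False by simp
    qed simp
    finally show ?thesis .
  qed
  have rhs: "poly.coeff (poly.coeff (?H (exp_at A \<phi> (indet_V A \<oplus>\<^bsub>UP (UP A)\<^esub> indet_U A) a)) j) i =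
      of_nat ((i + j) choose i) * h (\<phi> a (i + j))"
  proof -
    have "?H (exp_at A \<phi> (indet_V A \<oplus>\<^bsub>UP (UP A)\<^esub> indet_U A) a) =
        (\<Sum>n\<le>deg A (\<phi> a). [:[:h (\<phi> a n):]:] * (?V + ?U) ^ n)"
      using a V U by (simp only: at up2.h_add up2.a_closed)
    also have "\<dots> = (\<Sum>n\<le>deg A (\<phi> a). \<Sum>m\<le>n.
        [:[:of_nat (n choose m) * h (\<phi> a n):]:] * ?V ^ m * ?U ^ (n - m))"
      unfolding binomial_ring sum_distrib_left
      by (intro sum.cong refl) (simp add: of_nat_poly mult.assoc[symmetric] mult.commute)
    finally have "poly.coeff (poly.coeff (?H (exp_at A \<phi> (indet_V A \<oplus>\<^bsub>UP (UP A)\<^esub> indet_U A) a)) j) i =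
        (\<Sum>n\<le>deg A (\<phi> a). \<Sum>m\<le>n. if m = j \<and> n - m = i then of_nat (n choose m) * h (\<phi> a n) else 0)"
      by (simp only: coeff_sum coeff_coeff_VU)
    also have "\<dots> = (\<Sum>n\<le>deg A (\<phi> a). if n = i + j then of_nat ((i + j) choose i) * h (\<phi> a (i + j)) else 0)"
    proof (intro sum.cong refl)
      fix n
      have "(\<Sum>m\<le>n. if m = j \<and> n - m = i then of_nat (n choose m) * h (\<phi> a n) else 0) =
          (\<Sum>m\<le>n. if m = j then (if n = i + j then of_nat ((i + j) choose j) * h (\<phi> a (i + j)) else 0) else 0)"
        by (intro sum.cong refl) auto
      also have "(i + j) choose j = (i + j) choose i"
        by (metis binomial_symmetric diff_add_inverse2 le_add2)
      finally show "(\<Sum>m\<le>n. if m = j \<and> n - m = i then of_nat (n choose m) * h (\<phi> a n) else 0) =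
          (if n = i + j then of_nat ((i + j) choose i) * h (\<phi> a (i + j)) else 0)"
        by simp
    qed
    also have "\<dots> = of_nat ((i + j) choose i) * h (\<phi> a (i + j))"
      using h_above[OF a, of "i + j"] by (cases "i + j \<le> deg A (\<phi> a)") auto
    finally show ?thesis .
  qed
  show ?thesis
    using lhs rhs phi_phi[OF a] a by (simp add: coeff_Phi_h phi_coeff_in)
qed

end

section \<open>Invariants on the surface\<close>

lemma polyXYZ_simps [simp]:
  "carrier polyXYZ = UNIV" "a \<oplus>\<^bsub>polyXYZ\<^esub> b = a + b" "a \<otimes>\<^bsub>polyXYZ\<^esub> b = a * b"
  "\<one>\<^bsub>polyXYZ\<^esub> = 1" "\<zero>\<^bsub>polyXYZ\<^esub> = 0"
  by (simp_all add: polyXYZ_def ring_of_type_algebra_def)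

lemma cring_polyXYZ: "cring polyXYZ"
  unfolding polyXYZ_def by (rule cring_from_type_algebra)

lemma minus_polyXYZ: "a \<ominus>\<^bsub>polyXYZ\<^esub> b = a - b"
proof -
  interpret P: cring polyXYZ by (rule cring_polyXYZ)
  have "\<ominus>\<^bsub>polyXYZ\<^esub> b = - b" by (rule P.minus_equality) simp_all
  then show ?thesis by (simp add: a_minus_def)
qed

lemma ideal_surface: "ideal (surface_ideal f g) polyXYZ"
proof -
  interpret P: cring polyXYZ by (rule cring_polyXYZ)
  show ?thesis unfolding surface_ideal_def by (rule P.cgenideal_ideal) simp
qed

lemma mem_surface_ideal: "p \<in> surface_ideal f g \<longleftrightarrow> surface_rel f g dvd p"
  by (auto simp: surface_ideal_def cgenideal_def dvd_def mult.commute)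

lemma cring_surface_ring: "cring (surface_ring f g)"
  unfolding surface_ring_def by (rule ideal.quotient_is_cring[OF ideal_surface cring_polyXYZ])

lemma surface_class_hom: "surface_class f g \<in> ring_hom polyXYZ (surface_ring f g)"
proof -
  have "surface_class f g = (+>\<^bsub>polyXYZ\<^esub>) (surface_ideal f g)"
    by (rule ext) (simp add: surface_class_def)
  then show ?thesis
    unfolding surface_ring_def using ideal.rcos_ring_hom[OF ideal_surface] by simp
qed

lemma carrier_surface_ring: "carrier (surface_ring f g) = range (surface_class f g)"
  by (auto simp: surface_ring_def FactRing_def A_RCOSETS_def' surface_class_def)

lemma surface_class_eq_iff: "surface_class f g p = surface_class f g q \<longleftrightarrow> surface_rel f g dvd p - q"
proof -
  interpret P: cring polyXYZ by (rule cring_polyXYZ)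
  show ?thesis
    using P.quotient_eq_iff_same_a_r_cos[OF ideal_surface, of p q f g]
    by (simp add: surface_class_def minus_polyXYZ mem_surface_ideal)
qed

lemma surface_class_simps:
  "surface_class f g p \<oplus>\<^bsub>surface_ring f g\<^esub> surface_class f g q = surface_class f g (p + q)"
  "surface_class f g p \<otimes>\<^bsub>surface_ring f g\<^esub> surface_class f g q = surface_class f g (p * q)"
  "\<one>\<^bsub>surface_ring f g\<^esub> = surface_class f g 1"
  using ring_hom_add[OF surface_class_hom, of p q f g] ring_hom_mult[OF surface_class_hom, of p q f g]
    ring_hom_one[OF surface_class_hom, of f g]
  by simp_all

text \<open>
  Well defined on residue classes because the embedding vanishes on the ideal of the surface.
\<close>

definition coord ::
  "'k::field poly \<Rightarrow> 'k poly poly \<Rightarrow> 'k poly poly poly set \<Rightarrow> 'k fls poly" where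
  "coord f g a = embed f g (SOME p. surface_class f g p = a)"

lemma polynomial_in_x_generated:
  "surface_class f g [:[:w:]:] \<in>
    subalgebra_gen (surface_ring f g) (surface_const f g) {surface_class f g varX}"
  (is "_ \<in> ?G")
proof (induction w)
  case 0
  have "surface_const f g 0 \<in> ?G"
    unfolding subalgebra_gen_def by (intro generate_ring.incl) simp
  moreover have "surface_const f g 0 = surface_class f g [:[:0:]:]"
    by (simp add: surface_const_def)
  ultimately show ?case by (simp only:)
next
  case (pCons c w)
  have "surface_const f g c \<in> ?G" "surface_class f g varX \<in> ?G"
    unfolding subalgebra_gen_def by (intro generate_ring.incl; simp)+
  then have "surface_const f g c \<oplus>\<^bsub>surface_ring f g\<^esub>
      (surface_class f g varX \<otimes>\<^bsub>surface_ring f g\<^esub> surface_class f g [:[:w:]:]) \<in> ?G"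
    using pCons.IH unfolding subalgebra_gen_def
    by (intro generate_ring.eng_add generate_ring.eng_mult)
  moreover have "surface_const f g c \<oplus>\<^bsub>surface_ring f g\<^esub>
      (surface_class f g varX \<otimes>\<^bsub>surface_ring f g\<^esub> surface_class f g [:[:w:]:]) =
      surface_class f g [:[:pCons c w:]:]"
    by (simp add: surface_const_def surface_class_simps varX_def)
  ultimately show ?case by (simp only:)
qed

theorem theorem3p5:
  fixes f :: "'k::field poly" and g :: "'k poly poly"
    and \<phi> :: "'k poly poly poly set \<Rightarrow> nat \<Rightarrow> 'k poly poly poly set"
  assumes "lead_coeff f = 1" and "degree f \<ge> 2"
    and "lead_coeff g = 1" and "degree g \<ge> 2"
    and "exponential_map (surface_ring f g) (surface_const f g) \<phi>"
    and "\<not> trivial_exp (surface_ring f g) \<phi>"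
  shows "ring_of_invariants (surface_ring f g) \<phi> =
    subalgebra_gen (surface_ring f g) (surface_const f g) {surface_class f g varX}"
proof -
  note monic = assms(1-4)
  let ?A = "surface_ring f g" and ?cl = "surface_class f g"
  have coord: "coord f g (?cl p) = embed f g p" for p
  proof -
    have "?cl (SOME p'. ?cl p' = ?cl p) = ?cl p" by (rule someI) (rule refl)
    then have "embed f g ((SOME p'. ?cl p' = ?cl p) - p) = 0"
      unfolding surface_class_eq_iff embed_eq_0_iff[OF monic] .
    then show ?thesis by (simp add: coord_def embed_simps)
  qed
  interpret exponential_transfer ?A "coord f g" \<phi>
  proof (intro exponential_transfer.intro exponential_transfer_axioms.intro
      ring_to_type.intro ring_to_type_axioms.intro cring_surface_ring)
    show "inj_on (coord f g) (carrier ?A)"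
    proof (rule inj_onI)
      fix a b assume "a \<in> carrier ?A" "b \<in> carrier ?A" and eq: "coord f g a = coord f g b"
      then obtain p q where pq: "a = ?cl p" "b = ?cl q" by (auto simp: carrier_surface_ring)
      then have "embed f g (p - q) = 0" using eq by (simp add: coord embed_simps)
      then show "a = b" unfolding pq surface_class_eq_iff embed_eq_0_iff[OF monic] .
    qed
  qed (use assms(5) in \<open>auto simp: carrier_surface_ring surface_class_simps coord embed_simps
      exponential_map_def\<close>)
  have cl_in: "?cl p \<in> carrier ?A" for p by (simp add: carrier_surface_ring)
  have scal: "scal c = coord f g (surface_const f g c)" for c
    by (simp add: surface_const_def coord embed_pCons embXZ_pCons embX_pCons embX_simps
        embXZ_simps embed_simps scal_def)
  have x: "x_elt = coord f g (?cl varX)"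
    by (simp add: coord varX_def embed_pCons embXZ_pCons embX_pCons embX_simps
        embXZ_simps embed_simps x_elt_def)
  have z: "z_elt = coord f g (?cl [:[:0, 1:]:])"
    by (simp add: coord embed_pCons embXZ_pCons embX_simps embXZ_simps embed_simps flip: one_pCons)
  have y: "y_elt f g = coord f g (?cl varY)"
    by (simp add: coord varY_def embed_pCons embXZ_simps embed_simps)
  let ?B = "coord f g ` carrier ?A"
  have const_in: "surface_const f g c \<in> carrier ?A" for c
    unfolding surface_const_def by (rule cl_in)
  interpret E: exponential_subring ?B "y_elt f g" "degree f" "degree g" Phi
  proof
    show "degree f \<ge> 2" "degree g \<ge> 2" by (fact monic)+
    show "scal c \<in> ?B" "x_elt \<in> ?B" "y_elt f g \<in> ?B" "z_elt \<in> ?B" for c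
      unfolding scal x y z using cl_in const_in by blast+
    show "val (y_elt f g) = weight (- int (degree f)) (int (degree g))" "lead_scalar (y_elt f g) = 1"
      by (rule val_y[OF monic] lead_scalar_y[OF monic])+
    show "\<exists>i k j. val b = weight (int i - int (degree f) * int k) (int (degree g) * int k + int j)"
      if "b \<in> ?B" "b \<noteq> 0" for b
      using that val_embed[OF monic] by (auto simp: carrier_surface_ring coord)
    show "Phi (scal c) = [:scal c:]" for c
      unfolding scal using Phi_h_const[OF const_in] assms(5) by (auto simp: exponential_map_def)
  next
    fix a b assume "a \<in> ?B" "b \<in> ?B"
    then obtain a' b' where a: "a = coord f g a'" "a' \<in> carrier ?A"
      and b: "b = coord f g b'" "b' \<in> carrier ?A" by blast
    show "a + b \<in> ?B" "a * b \<in> ?B"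
      unfolding a(1) b(1) using a(2) b(2) by (simp_all flip: h_add h_mult)
    show "Phi (a + b) = Phi a + Phi b" "Phi (a * b) = Phi a * Phi b"
      unfolding a(1) b(1) using a(2) b(2) by (simp_all add: Phi_h_add Phi_h_mult)
  next
    fix b i j assume "b \<in> ?B"
    then obtain a where a: "b = coord f g a" "a \<in> carrier ?A" by blast
    show "poly.coeff (Phi b) i \<in> ?B" "poly.coeff (Phi b) 0 = b"
      unfolding a(1) using a(2) coeff_Phi_h_0[OF a(2)]
      by (auto simp: coeff_Phi_h phi_coeff_in)
    show "poly.coeff (Phi (poly.coeff (Phi b) i)) j =
        of_nat ((i + j) choose i) * poly.coeff (Phi b) (i + j)"
      unfolding a(1) by (rule Phi_Phi_h[OF a(2)])
  qed
  have inv: "a \<in> ring_of_invariants ?A \<phi> \<longleftrightarrow> a \<in> carrier ?A \<and> Phi (coord f g a) = [:coord f g a:]" for a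
    by (auto simp: ring_of_invariants_def Phi_h_const)
  obtain b where b: "b \<in> ?B" "Phi b \<noteq> [:b:]"
    using assms(6) inv unfolding trivial_exp_def by blast
  show ?thesis
  proof (rule Set.set_eqI, rule iffI)
    fix a assume "a \<in> ring_of_invariants ?A \<phi>"
    then have a: "a \<in> carrier ?A" "Phi (coord f g a) = [:coord f g a:]"
      by (simp_all add: inv)
    then have "degree (coord f g a) = 0"
      using E.invariants_have_z_degree_0[OF b] by blast
    then obtain w where "coord f g a = [:embX w:]"
      using E.poly_in_x_if_z_degree_0 a(1) by blast
    also have "\<dots> = coord f g (?cl [:[:w:]:])"
      by (simp add: coord embed_pCons embXZ_pCons embXZ_simps embed_simps)
    finally have "a = ?cl [:[:w:]:]"
      using h_inj a(1) cl_in by (auto dest: inj_onD)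
    then show "a \<in> subalgebra_gen ?A (surface_const f g) {?cl varX}"
      using polynomial_in_x_generated by simp
  next
    fix a assume "a \<in> subalgebra_gen ?A (surface_const f g) {?cl varX}"
    then have "a \<in> generate_ring ?A (range (surface_const f g) \<union> {?cl varX})"
      by (simp add: subalgebra_gen_def)
    then have "a \<in> carrier ?A \<and> Phi (coord f g a) = [:coord f g a:]"
    proof (induction rule: generate_ring.induct)
      case one
      show ?case using E.Phi_1 by (simp add: h_one one_pCons)
    next
      case (incl a)
      then show ?case
        using E.x_invariant[OF b] E.Phi_scal by (auto simp: const_in cl_in simp flip: scal x)
    next
      case (a_inv a)
      then have "coord f g (\<ominus>\<^bsub>?A\<^esub> a) + coord f g a = 0"
        by (simp add: h_zero flip: h_add add: l_neg)
      then have minus: "coord f g (\<ominus>\<^bsub>?A\<^esub> a) = - coord f g a"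
        by (simp add: eq_neg_iff_add_eq_0)
      have "Phi (coord f g (\<ominus>\<^bsub>?A\<^esub> a)) + Phi (coord f g a) = Phi (coord f g (\<ominus>\<^bsub>?A\<^esub> a) + coord f g a)"
        using a_inv by (intro Phi_h_add[symmetric]) auto
      also have "\<dots> = 0" using E.Phi_0 by (simp add: minus)
      finally have "Phi (coord f g (\<ominus>\<^bsub>?A\<^esub> a)) = - Phi (coord f g a)"
        by (simp only: eq_neg_iff_add_eq_0)
      then show ?case using a_inv by (simp add: minus)
    next
      case (eng_add a b)
      then show ?case by (simp add: h_add Phi_h_add)
    next
      case (eng_mult a b)
      then show ?case by (simp add: h_mult Phi_h_mult mult.commute)
    qed
    then show "a \<in> ring_of_invariants ?A \<phi>" by (simp add: inv)
  qed
qed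

end
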